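(* Let $d\ge2$, let $\Psi=(\psi_1,\ldots,\psi_r)\in\mathbb{R}^{m\times r}$ with $\max_{1\le j\le r}\|\psi_j\|_2\le1$, and let $X:=\Psi\otimes\cdots\otimes\Psi$ ($d$ times). Suppose that there exists a nested sequence of approximations for $\Psi$, with parameters $(q,\gamma,W)$. Then $$M(\epsilon,X)\lesssim\epsilon^{-W}\log^{\frac{(d-1)(2+W)}{2}}(1/\epsilon).$$ If in addition $N(\epsilon,\Psi)\lesssim\epsilon^{-V}$ for some constant $V$, then $N(\epsilon,X)\lesssim\epsilon^{-dV}$, and, with $\mathcal{F}:=\mathrm{absconv}(X)$, $$\mathcal{H}(\epsilon,\mathcal{F})\lesssim\epsilon^{-\frac{2W}{2+W}}\log^{d-1}(1/\epsilon)\,\log^{\frac{W}{2+W}}(1/\epsilon).$$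
   Context: A matrix is identified with the set of its columns; $\otimes$ is the tensor (Kronecker) product, so the columns of $X\in\mathbb{R}^{m^d\times r^d}$ are the vectors $\psi_{j_1}\otimes\cdots\otimes\psi_{j_d}$. $\|\cdot\|_2$ and $\|\cdot\|_1$ are the $\ell_2$- and $\ell_1$-norms. For $X\in\mathbb{R}^{n\times p}$, $\mathrm{absconv}(X):=\{X\beta:\beta\in\mathbb{R}^p,\ \|\beta\|_1\le1\}$. For a subset $T$ of a metric space, $N(\epsilon,T)$ is the minimum number of balls with radius $\epsilon$ necessary to cover $T$, and $\mathcal{H}(\epsilon,T):=\log N(\epsilon,T)$. The metric here is the Euclidean one. For a matrix $X=(x_1,\ldots,x_p)\in\mathbb{R}^{n\times p}$ and a linear space $\mathcal{V}\subset\mathbb{R}^n$, let $x^{\mathcal{V}^\perp}$ be the projection of $x$ on the orthocomplement of $\mathcal{V}$, and $\delta(\mathcal{V},X):=\max_{1\le j\le p}\|x_j^{\mathcal{V}^\perp}\|_2$. For $N\in\mathbb{N}$ put $\delta_N(X):=\min\{\delta(\mathcal{V},X):\dim(\mathcal{V})=N\}$, and for $\epsilon>0$ put $M(\epsilon,X):=\min\{N:\delta_N(X)\le\epsilon\}$. Given $q\in\mathbb{N}$, a nested sequence of linear spaces with starting value $q$ is a sequence $\{\mathcal{V}_k\}_{k\ge0}$ where $\mathcal{V}_0$ is a $q$-dimensional linear subspace of $\mathbb{R}^m$ and, for $k=1,2,\ldots$, $\mathcal{V}_k\supset\mathcal{V}_{k-1}$ is a linear space with dimension $q2^k$. For $q\in\mathbb{N}$,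 $\gamma>0$, $W>0$, a nested sequence of approximations for $\Psi$ with parameters $(q,\gamma,W)$ is a nested sequence of linear spaces $\{\mathcal{V}_k\}_{k\ge0}$ with starting value $q$ such that $\delta(\mathcal{V}_k,\Psi)\le\gamma2^{-k/W}$ for all $k\in\mathbb{N}=\{1,2,\ldots\}$. If $g$ and $h$ are functions on $(0,1]$, with $h$ possibly depending on the matrix dimensions but $g$ not, then $h(\epsilon)\lesssim g(\epsilon)$ means $\limsup_{\epsilon\downarrow0}h(\epsilon)/g(\epsilon)\le C<\infty$, where $C$ does not depend on the matrix dimensions.
   Formalization: In a nested sequence of linear spaces in R^m, the dimension of V_k is taken to be min(q2^k, m) for k ≥ 1, since dimension q2^k for every k is impossible in R^m; ≲ is read as a bound uniform over families of matrices Ψ with common d, q, γ, W. *)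

theory Defs
  imports
    "HOL-Library.Extended_Real"
    "Jordan_Normal_Form.VS_Connect"
begin

text \<open>
  Vectors and matrices are those of Jordan_Normal_Form, whose dimensions are values and not
  types: the constants hidden in the relation defined at the end of this theory have to be
  uniform over matrices of different sizes. Below, the ambient space of the columns of a matrix
  is \<open>carrier_vec (dim_row X)\<close>.
\<close>

section \<open>Euclidean geometry\<close>

definition l2norm :: "real Matrix.vec \<Rightarrow> real" where
  "l2norm v = sqrt (v \<bullet> v)"

definition l2dist :: "real Matrix.vec \<Rightarrow> real Matrix.vec \<Rightarrow> real" where
  "l2dist u v = l2norm (u - v)"

definition l1norm :: "real Matrix.vec \<Rightarrow> real" where
  "l1norm v = (\<Sum>i<dim_vec v. \<bar>vec_index v i\<bar>)"

definition linear_space_of_dim :: "nat \<Rightarrow> nat \<Rightarrow> real Matrix.vec set \<Rightarrow> bool" where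
  "linear_space_of_dim n N V \<longleftrightarrow>
     VectorSpace.subspace class_ring V (module_vec TYPE(real) n) \<and>
     vectorspace.dim class_ring ((module_vec TYPE(real) n)\<lparr>carrier := V\<rparr>) = N"

definition proj_orthocomp :: "nat \<Rightarrow> real Matrix.vec set \<Rightarrow> real Matrix.vec \<Rightarrow> real Matrix.vec" where
  "proj_orthocomp n V x =
     (THE u. u \<in> vec_module.orthogonal_complement n V \<and> x - u \<in> V)"

section \<open>Tensor powers and absolute convex hull\<close>

definition kron :: "real Matrix.mat \<Rightarrow> real Matrix.mat \<Rightarrow> real Matrix.mat" where
  "kron A B = Matrix.mat (dim_row A * dim_row B) (dim_col A * dim_col B)
     (\<lambda>(i, j). A $$ (i div dim_row B, j div dim_col B) * B $$ (i mod dim_row B, j mod dim_col B))"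

primrec tensor_power :: "real Matrix.mat \<Rightarrow> nat \<Rightarrow> real Matrix.mat" where
  "tensor_power A 0 = 1\<^sub>m 1"
| "tensor_power A (Suc d) = kron A (tensor_power A d)"

definition absconv :: "real Matrix.mat \<Rightarrow> real Matrix.vec set" where
  "absconv X = {X *\<^sub>v \<beta> | \<beta>. \<beta> \<in> carrier_vec (dim_col X) \<and> l1norm \<beta> \<le> 1}"

section \<open>Covering numbers and entropy\<close>

text \<open>The balls are closed and their centres are arbitrary points of the ambient space.\<close>

definition covering_number :: "nat \<Rightarrow> real \<Rightarrow> real Matrix.vec set \<Rightarrow> nat" where
  "covering_number n \<epsilon> T =
     (LEAST k. \<exists>C\<subseteq>carrier_vec n. finite C \<and> card C = k \<and> T \<subseteq> (\<Union>c\<in>C. {x. l2dist x c \<le> \<epsilon>}))"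

definition covering_cols :: "real \<Rightarrow> real Matrix.mat \<Rightarrow> nat" where
  "covering_cols \<epsilon> X = covering_number (dim_row X) \<epsilon> (set (cols X))"

definition entropy :: "nat \<Rightarrow> real \<Rightarrow> real Matrix.vec set \<Rightarrow> real" where
  "entropy n \<epsilon> T = ln (real (covering_number n \<epsilon> T))"

section \<open>Approximation by linear spaces\<close>

definition approx_err :: "real Matrix.vec set \<Rightarrow> real Matrix.mat \<Rightarrow> real" where
  "approx_err V X = Max ((\<lambda>j. l2norm (proj_orthocomp (dim_row X) V (Matrix.col X j))) ` {..<dim_col X})"

definition approx_err_dim :: "nat \<Rightarrow> real Matrix.mat \<Rightarrow> real" where
  "approx_err_dim N X = Inf {approx_err V X | V. linear_space_of_dim (dim_row X) N V}"

text \<open>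
  The range of \<open>N\<close> stops at the dimension of the ambient space because \<open>approx_err_dim\<close> is
  only meaningful if there is a linear space of dimension \<open>N\<close>.
\<close>

definition approx_dim :: "real \<Rightarrow> real Matrix.mat \<Rightarrow> nat" where
  "approx_dim \<epsilon> X = (LEAST N. N \<in> {1..dim_row X} \<and> approx_err_dim N X \<le> \<epsilon>)"

text \<open>
  The dimensions are required to be \<open>q * 2 ^ k\<close> as long as \<open>m\<close>-space is large enough
  for that, and \<open>m\<close> afterwards. Demanding \<open>q * 2 ^ k\<close> for every \<open>k\<close> would
  exclude all sequences, since \<open>m\<close> is finite and \<open>q\<close> positive.
\<close>

definition nested_spaces :: "nat \<Rightarrow> nat \<Rightarrow> (nat \<Rightarrow> real Matrix.vec set) \<Rightarrow> bool" where
  "nested_spaces m q V \<longleftrightarrow>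
     linear_space_of_dim m q (V 0) \<and>
     (\<forall>k\<ge>1. V (k - 1) \<subseteq> V k \<and> linear_space_of_dim m (min (q * 2 ^ k) m) (V k))"

definition nested_approximations ::
    "real Matrix.mat \<Rightarrow> nat \<Rightarrow> real \<Rightarrow> real \<Rightarrow> (nat \<Rightarrow> real Matrix.vec set) \<Rightarrow> bool" where
  "nested_approximations \<Psi> q \<gamma> W V \<longleftrightarrow>
     nested_spaces (dim_row \<Psi>) q V \<and>
     (\<forall>k\<ge>1. approx_err (V k) \<Psi> \<le> \<gamma> * 2 powr (- real k / W))"

section \<open>Bounds uniform in the matrix\<close>

text \<open>
  \<open>h\<close> depends on a matrix from a family \<open>\<M>\<close> and \<open>g\<close> does not. The supremum over
  the family is inside the limit superior, so that the relation is a bound that is uniform over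
  the family, in particular over the dimensions. With the supremum outside, the relation would
  have no content here: for a single matrix \<open>approx_dim\<close> and \<open>covering_cols\<close> are
  bounded and \<open>entropy\<close> grows like \<open>ln (1 / \<epsilon>)\<close>, so that the quotients
  with a negative power of \<open>\<epsilon>\<close> tend to 0.
\<close>

definition lesssim_on :: "real Matrix.mat set \<Rightarrow> (real Matrix.mat \<Rightarrow> real \<Rightarrow> real) \<Rightarrow> (real \<Rightarrow> real) \<Rightarrow> bool" where
  "lesssim_on \<M> h g \<longleftrightarrow>
     (\<exists>C::real. Limsup (at_right 0) (\<lambda>\<epsilon>. SUP \<Psi>\<in>\<M>. ereal (h \<Psi> \<epsilon> / g \<epsilon>)) \<le> ereal C)"

end

theory Submission
  imports
    Defs
    "HOL-Analysis.L2_Norm"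
    "HOL-Library.FuncSet"
    "HOL-Real_Asymp.Real_Asymp"
begin

text \<open>
  Let \<open>V 0 \<subseteq> V 1 \<subseteq> \<dots>\<close> be the nested spaces and choose one orthonormal basis of \<open>m\<close>-space
  whose initial segments span all of them. Give a basis vector level \<open>k\<close> if it enters with
  \<open>V k\<close>. There are at most \<open>q * 2 ^ k\<close> vectors of level \<open>k\<close>, and a column of \<open>\<Psi>\<close> has squared
  coordinates on level \<open>k\<close> with sum of order \<open>2 powr (- 2 * k / W)\<close>. The tensor products of the
  basis vectors form an orthonormal basis for \<open>\<Psi> \<otimes> \<dots> \<otimes> \<Psi>\<close>, and both the number of
  vectors and the squared mass are multiplicative. If the level of a tensor product is the sum of
  the levels of its factors, then counting the ways to split a sum \<open>s\<close> into \<open>d\<close> levels costs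
  only a factor \<open>Suc s ^ (d - 1)\<close>. So the \<^emph>\<open>hyperbolic cross\<close> of the basis vectors of
  level at most \<open>K\<close> has of the order of \<open>Suc K ^ (d - 1) * 2 ^ K\<close> elements and leaves a squared
  error of order \<open>Suc K ^ (d - 1) * 2 powr (- 2 * K / W)\<close> (\<open>hyperbolic_cross\<close>). Eliminating
  \<open>K\<close> gives the bound on \<open>approx_dim\<close> (\<open>approx_dim_asymptotic\<close>).

  The columns of a tensor power depend on the columns of the factors in a Lipschitz way, as all of
  these have norm at most 1. A net for the columns of \<open>\<Psi>\<close> therefore gives a net for the columns
  of the tensor power whose size is the \<open>d\<close>-th power (\<open>col_net_tensor_power\<close>).

  For the entropy, replace the columns by a net of polynomial size; the logarithm \<open>\<Lambda>\<close> of the size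
  is of order \<open>ln (1 / \<epsilon>)\<close>. Covering the projection of the convex hull on the cross of level \<open>K\<close>
  in one step would cost a factor \<open>ln (1 / \<epsilon>)\<close> in the exponent. This is avoided by refining a
  cover level by level, with radii
  \<open>\<rho> k = sqrt \<Lambda> * 2 powr (- k * (1 / W + 1 / 2))\<close> (\<open>covered_by_abs_hull_chain\<close>). Consecutive radii
  have a constant ratio, so within the \<open>k\<close>-th cross a ball of radius \<open>\<rho> (k - 1)\<close> is covered by
  exponentially many balls of radius \<open>\<rho> k / 2\<close>, with a constant times the dimension in the
  exponent (\<open>covered_by_ball\<close>, a count of lattice points). Outside the cross, the hull is generated
  by short vectors and is covered by averages of few generators (\<open>covered_by_abs_hull\<close>, the
  argument of Maurey). The radii are chosen such that both contributions are of the order of the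
  dimension of the cross. These dimensions grow geometrically, so the last one dominates.
\<close>

section \<open>Orthonormal sets in linear spaces\<close>

lemma scalar_prod_self: "v \<bullet> v = (\<Sum>i<dim_vec v. (v $ i)\<^sup>2)" for v :: "real Matrix.vec"
  by (simp add: scalar_prod_def power2_eq_square lessThan_atLeast0)

lemma scalar_prod_self_pos:
  fixes v :: "real Matrix.vec"
  assumes "v \<in> carrier_vec n" "v \<noteq> 0\<^sub>v n"
  shows "v \<bullet> v > 0"
proof -
  obtain i where "i < n" "v $ i \<noteq> 0" using assms by (metis carrier_vecD eq_vecI index_zero_vec(1) index_zero_vec(2))
  then show ?thesis using assms unfolding scalar_prod_self
    by (intro sum_pos2[of _ i]) auto
qed

lemma l2norm_eq_L2_set: "l2norm v = L2_set (($) v) {..<dim_vec v}"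
  by (simp add: l2norm_def L2_set_def scalar_prod_self)

definition orthonormal_vecs :: "nat \<Rightarrow> real Matrix.vec set \<Rightarrow> bool" where
  "orthonormal_vecs n U \<longleftrightarrow> finite U \<and> U \<subseteq> carrier_vec n \<and>
     (\<forall>u\<in>U. \<forall>w\<in>U. u \<bullet> w = (if u = w then 1 else 0))"

context
  fixes n :: nat
begin

interpretation vec_space "TYPE(real)" n .

lemma orthonormal_lin_indpt:
  assumes "orthonormal_vecs n U"
  shows "lin_indpt U"
proof -
  have fin: "finite U" and U: "U \<subseteq> carrier_vec n"
    and on: "\<And>u w. u \<in> U \<Longrightarrow> w \<in> U \<Longrightarrow> u \<bullet> w = (if u = w then 1 else 0)"
    using assms by (auto simp: orthonormal_vecs_def)
  show ?thesis
  proof (rule finite_lin_indpt2[OF fin U])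
    fix a :: "real Matrix.vec \<Rightarrow> real"
    assume z: "lincomb a U = 0\<^sub>v n"
    show "\<forall>v\<in>U. a v = 0"
    proof
      fix v assume v: "v \<in> U"
      have "0 = lincomb a U \<bullet> v" using z U v by auto
      also have "\<dots> = (\<Sum>u\<in>U. (a u \<cdot>\<^sub>v u) \<bullet> v)"
        unfolding lincomb_def by (rule finsum_scalar_prod_sum) (use U v in auto)
      also have "\<dots> = (\<Sum>u\<in>U. if u = v then a v else 0)"
        by (rule sum.cong) (use on v U in \<open>auto simp: smult_scalar_prod_distrib[where n=n] subset_iff\<close>)
      also have "\<dots> = a v" using fin v by simp
      finally show "a v = 0" by simp
    qed
  qed
qed

lemma linear_space_of_dimD:
  assumes "linear_space_of_dim n N W"
  shows "W \<subseteq> carrier_vec n" "submodule class_ring W V"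
    "0\<^sub>v n \<in> W" "\<And>v w. v \<in> W \<Longrightarrow> w \<in> W \<Longrightarrow> v + w \<in> W" "\<And>v c. v \<in> W \<Longrightarrow> c \<cdot>\<^sub>v v \<in> W"
    "vectorspace class_ring (vs W)" "vectorspace.fin_dim class_ring (vs W)"
    "vectorspace.dim class_ring (vs W) = N"
proof -
  have sub: "VectorSpace.subspace class_ring W V" and d: "vectorspace.dim class_ring (vs W) = N"
    using assms by (auto simp: linear_space_of_dim_def)
  show sm: "submodule class_ring W V" using sub by (simp add: VectorSpace.subspace_def)
  show *: "vectorspace class_ring (vs W)" using sub by (rule subspace_is_vs)
  show W: "W \<subseteq> carrier_vec n" using submodule.subset[OF sm] by (simp add: module_vec_simps)
  show "0\<^sub>v n \<in> W" using submodule.zero_closed[OF sm] by (simp add: module_vec_simps)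
  show "\<And>v w. v \<in> W \<Longrightarrow> w \<in> W \<Longrightarrow> v + w \<in> W"
    using submodule.m_closed[OF sm] by (simp add: module_vec_simps)
  show "\<And>v c. v \<in> W \<Longrightarrow> c \<cdot>\<^sub>v v \<in> W"
    using submodule.smult_closed[OF sm] by (simp add: module_vec_simps)
  show "vectorspace.dim class_ring (vs W) = N" by fact
  \<comment> \<open>Independent subsets of \<open>W\<close> are independent in \<open>n\<close>-space, so there is a maximal one, and
    it is a finite basis.\<close>
  show "vectorspace.fin_dim class_ring (vs W)"
  proof -
    interpret W: vectorspace class_ring "vs W" by fact
    have bound: "finite A \<and> card A \<le> n" if A: "A \<subseteq> carrier (vs W) \<and> W.lin_indpt A" for A
    proof -
      have AW: "A \<subseteq> W" using A by simp
      have "lin_indpt A" using span_li_not_depend(2)[OF AW sm] A by simp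
      then show ?thesis using li_le_dim[of A] A W dim_is_n by auto
    qed
    have "W.lin_indpt {}" by (auto simp: W.lin_dep_def)
    then obtain A where "finite A" "maximal A (\<lambda>S. S \<subseteq> carrier (vs W) \<and> W.lin_indpt S)"
      using maximal_exists[of "\<lambda>S. S \<subseteq> carrier (vs W) \<and> W.lin_indpt S" n "{}"] bound by auto
    then show ?thesis
      using W.max_li_is_basis[of A] unfolding W.fin_dim_def W.basis_def by auto
  qed
qed

lemma orthonormal_card_le_dim:
  assumes W: "linear_space_of_dim n N W" and U: "orthonormal_vecs n U" "U \<subseteq> W"
  shows "card U \<le> N"
proof -
  note D = linear_space_of_dimD[OF W]
  interpret W: vectorspace class_ring "vs W" by (rule D)
  have "W.lin_indpt U"
    using span_li_not_depend(2)[OF U(2) D(2)] orthonormal_lin_indpt[OF U(1)] by simp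
  then show ?thesis using W.li_le_dim(2)[of U] D(7,8) U(2) by auto
qed

text \<open>
  The vector \<open>p\<close> is the projection of \<open>v\<close> on the span of \<open>U\<close>, built up one vector at a time.
  The set \<open>C\<close> records a linear condition that it inherits from \<open>U\<close>, such as membership in a
  larger space or orthogonality to a given vector.
\<close>

lemma orthogonal_remainder:
  assumes U: "orthonormal_vecs n U" and v: "v \<in> carrier_vec n"
    and C: "\<And>v w. v \<in> C \<Longrightarrow> w \<in> C \<Longrightarrow> v + w \<in> C" "\<And>v c. v \<in> C \<Longrightarrow> c \<cdot>\<^sub>v v \<in> C"
    and UC: "U \<subseteq> C" "0\<^sub>v n \<in> C"
  shows "\<exists>p\<in>carrier_vec n. p \<in> C \<and> (\<forall>u\<in>U. (v - p) \<bullet> u = 0)"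
proof -
  have "finite U" using U by (simp add: orthonormal_vecs_def)
  then show ?thesis using U UC(1)
  proof (induction U)
    case empty then show ?case using UC(2) by auto
  next
    case (insert u U)
    have on: "\<And>u' w. u' \<in> insert u U \<Longrightarrow> w \<in> insert u U \<Longrightarrow> u' \<bullet> w = (if u' = w then 1 else 0)"
      and cU: "insert u U \<subseteq> carrier_vec n"
      using insert.prems by (auto simp: orthonormal_vecs_def)
    have "orthonormal_vecs n U" using insert.prems by (auto simp: orthonormal_vecs_def)
    then obtain p where p: "p \<in> carrier_vec n" "p \<in> C" "\<forall>w\<in>U. (v - p) \<bullet> w = 0"
      using insert.IH insert.prems by auto
    let ?c = "(v - p) \<bullet> u" 
    let ?p = "p + ?c \<cdot>\<^sub>v u"
    have "(v - ?p) \<bullet> w = (v - p) \<bullet> w - ?c * (u \<bullet> w)" if "w \<in> insert u U" for w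
    proof -
      have "w \<in> carrier_vec n" "u \<in> carrier_vec n" using cU that by auto
      moreover have "v - ?p = (v - p) - ?c \<cdot>\<^sub>v u" using p v calculation by auto
      ultimately show ?thesis using p v
        by (simp add: minus_scalar_prod_distrib[where n=n])
    qed
    then have "\<forall>w\<in>insert u U. (v - ?p) \<bullet> w = 0"
      using p(3) on insert.hyps by (auto split: if_splits)
    moreover have "?p \<in> C" "?p \<in> carrier_vec n" using C p(1,2) insert.prems cU by auto
    ultimately show ?case by blast
  qed
qed

lemma orthonormal_insert:
  assumes U: "orthonormal_vecs n U" and r: "r \<in> carrier_vec n" "r \<noteq> 0\<^sub>v n" "\<forall>u\<in>U. r \<bullet> u = 0"
  shows "\<exists>c. c \<cdot>\<^sub>v r \<notin> U \<and> orthonormal_vecs n (insert (c \<cdot>\<^sub>v r) U)"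
proof -
  have finU: "finite U" and cU: "U \<subseteq> carrier_vec n"
    and on: "\<And>u w. u \<in> U \<Longrightarrow> w \<in> U \<Longrightarrow> u \<bullet> w = (if u = w then 1 else 0)"
    using U by (auto simp: orthonormal_vecs_def)
  have pos: "r \<bullet> r > 0" by (rule scalar_prod_self_pos[OF r(1,2)])
  define w where "w = (1 / sqrt (r \<bullet> r)) \<cdot>\<^sub>v r"
  have wc: "w \<in> carrier_vec n" using r by (simp add: w_def)
  have ww: "w \<bullet> w = 1" using r pos by (simp add: w_def)
  have wu: "w \<bullet> u = 0" if "u \<in> U" for u using that r cU by (auto simp: w_def)
  have uw: "u \<bullet> w = 0" if "u \<in> U" for u
    using comm_scalar_prod[of w n u] wu[OF that] wc cU that by auto
  have "w \<notin> U" using ww wu by force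
  then have "orthonormal_vecs n (insert w U)"
    using finU cU wc ww wu uw on unfolding orthonormal_vecs_def by auto
  with \<open>w \<notin> U\<close> show ?thesis unfolding w_def by blast
qed

lemma orthonormal_extend:
  assumes W: "linear_space_of_dim n N W" and U: "orthonormal_vecs n U" "U \<subseteq> W" "card U < N"
  shows "\<exists>v\<in>W. v \<notin> U \<and> orthonormal_vecs n (insert v U)"
proof -
  note D = linear_space_of_dimD[OF W]
  interpret W: vectorspace class_ring "vs W" by (rule D)
  have finU: "finite U" and cU: "U \<subseteq> carrier_vec n"
    using U by (auto simp: orthonormal_vecs_def)
  have "\<not> W.gen_set U" using W.gen_ge_dim[OF finU] U D(8) by auto
  moreover have "span U \<subseteq> W" using span_is_subset[OF U(2) D(2)] .
  ultimately obtain v where v: "v \<in> W" "v \<notin> span U"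
    using span_li_not_depend(1)[OF U(2) D(2)] by auto
  have vc: "v \<in> carrier_vec n" using v D by auto
  have sp: "submodule class_ring (span U) V" using span_is_submodule[OF cU] .
  have "0\<^sub>v n \<in> span U" using submodule.zero_closed[OF sp] by (simp add: module_vec_simps)
  then obtain p where p: "p \<in> carrier_vec n" "p \<in> span U" "\<forall>u\<in>U. (v - p) \<bullet> u = 0"
    using orthogonal_remainder[OF U(1) vc, of "span U"] in_own_span[OF cU]
      submodule.m_closed[OF sp] submodule.smult_closed[OF sp] 
    by (auto simp: module_vec_simps)
  have pW: "p \<in> W" using p \<open>span U \<subseteq> W\<close> by auto
  have r: "v - p \<in> carrier_vec n" using p vc by auto
  have "v - p = v + (-1) \<cdot>\<^sub>v p" using p vc by auto
  then have rW: "v - p \<in> W" using D(4,5) v(1) pW by auto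
  have r0: "v - p \<noteq> 0\<^sub>v n"
  proof
    assume "v - p = 0\<^sub>v n"
    then have "(v - p) + p = p" using p by simp
    moreover have "(v - p) + p = v" using p vc by (intro eq_vecI) auto
    ultimately show False using p v by simp
  qed
  show ?thesis using orthonormal_insert[OF U(1) r r0 p(3)] D(5)[OF rW] by blast
qed

text \<open>
  An orthonormal set of maximal size in \<open>W\<close> spans \<open>W\<close>: a nonzero remainder of a vector of
  \<open>W\<close> could be normalised and added to the set. So \<open>v\<close> equals its projection \<open>p\<close>, which is
  orthogonal to \<open>z\<close> because the members of \<open>U\<close> are.
\<close>

lemma orthogonal_to_maximal_orthonormal:
  assumes W: "linear_space_of_dim n N W" and U: "orthonormal_vecs n U" "U \<subseteq> W" "card U = N"
    and z: "z \<in> carrier_vec n" "\<forall>u\<in>U. z \<bullet> u = 0" and v: "v \<in> W"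
  shows "z \<bullet> v = 0"
proof -
  note D = linear_space_of_dimD[OF W]
  have vc: "v \<in> carrier_vec n" using v D by auto
  define C where "C = {p \<in> W. z \<bullet> p = 0}"
  have "\<exists>p\<in>carrier_vec n. p \<in> C \<and> (\<forall>u\<in>U. (v - p) \<bullet> u = 0)"
  proof (rule orthogonal_remainder[OF U(1) vc])
    show "v + w \<in> C" if "v \<in> C" "w \<in> C" for v w
    proof -
      have "v \<in> carrier_vec n" "w \<in> carrier_vec n" using that D(1) by (auto simp: C_def)
      then show ?thesis using that z D(4) by (auto simp: C_def scalar_prod_add_distrib[where n=n])
    qed
    show "c \<cdot>\<^sub>v v \<in> C" if "v \<in> C" for v c
    proof -
      have "v \<in> carrier_vec n" using that D(1) by (auto simp: C_def)
      then show ?thesis using that z D(5) by (auto simp: C_def)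
    qed
    show "U \<subseteq> C" using U z by (auto simp: C_def)
    show "0\<^sub>v n \<in> C" using D(3) z by (auto simp: C_def)
  qed
  then obtain p where p: "p \<in> carrier_vec n" "p \<in> W" "z \<bullet> p = 0" "\<forall>u\<in>U. (v - p) \<bullet> u = 0"
    by (auto simp: C_def)
  have r: "v - p \<in> carrier_vec n" using p vc by auto
  have "v - p = v + (-1) \<cdot>\<^sub>v p" using p vc by auto
  then have rW: "v - p \<in> W" using D(4,5) v(1) p by auto
  have "v - p = 0\<^sub>v n"
  proof (rule ccontr)
    assume "v - p \<noteq> 0\<^sub>v n"
    from orthonormal_insert[OF U(1) r this p(4)] obtain c where
      c: "c \<cdot>\<^sub>v (v - p) \<notin> U" "orthonormal_vecs n (insert (c \<cdot>\<^sub>v (v - p)) U)" by blast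
    have "card (insert (c \<cdot>\<^sub>v (v - p)) U) \<le> N"
      using orthonormal_card_le_dim[OF W c(2)] U(2) D(5)[OF rW] by auto
    then show False using c U by (auto simp: orthonormal_vecs_def)
  qed
  then have "(v - p) + p = p" using p by simp
  moreover have "(v - p) + p = v" using p vc by (intro eq_vecI) auto
  ultimately show ?thesis using p by simp
qed

lemma linear_space_span_orthonormal:
  assumes U: "orthonormal_vecs n U"
  shows "linear_space_of_dim n (card U) (span U)"
proof -
  have finU: "finite U" and cU: "U \<subseteq> carrier_vec n"
    using U by (auto simp: orthonormal_vecs_def)
  have sub: "VectorSpace.subspace class_ring (span U) V" using span_is_subspace[of U] cU by simp
  then interpret W: vectorspace class_ring "vs (span U)" by (rule subspace_is_vs)
  have sp: "submodule class_ring (span U) V" using span_is_submodule[OF cU] .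
  have UU: "U \<subseteq> span U" by (rule in_own_span[OF cU])
  have "W.basis U" unfolding W.basis_def
    using span_li_not_depend[OF UU sp] orthonormal_lin_indpt[OF U] UU by auto
  then have "W.dim = card U" using W.dim_basis[OF finU] by simp
  then show ?thesis using sub by (simp add: linear_space_of_dim_def)
qed

text \<open>
  Uniqueness of the orthogonal decomposition, which makes the description operator in
  \<open>proj_orthocomp\<close> meaningful.
\<close>

lemma proj_orthocomp_eqI:
  assumes W: "linear_space_of_dim n N W" and x: "x \<in> carrier_vec n"
    and u: "u \<in> carrier_vec n" "\<And>y. y \<in> W \<Longrightarrow> u \<bullet> y = 0" "x - u \<in> W"
  shows "proj_orthocomp n W x = u"
  unfolding proj_orthocomp_def
proof (rule the_equality)
  note D = linear_space_of_dimD[OF W]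
  show "u \<in> orthogonal_complement W \<and> x - u \<in> W" using u by (auto simp: orthogonal_complement_def)
  fix u' assume "u' \<in> orthogonal_complement W \<and> x - u' \<in> W"
  then have u': "u' \<in> carrier_vec n" "\<And>y. y \<in> W \<Longrightarrow> u' \<bullet> y = 0" "x - u' \<in> W"
    by (auto simp: orthogonal_complement_def)
  have e: "u' - u = (x - u) + (-1) \<cdot>\<^sub>v (x - u')" using u u' x by (intro eq_vecI) auto
  have "u' - u \<in> W" unfolding e using u(3) u'(3) D(4,5) by blast
  then have "(u' - u) \<bullet> (u' - u) = 0"
    using u u' by (simp add: minus_scalar_prod_distrib[where n=n])
  then have "u' - u = 0\<^sub>v n" using scalar_prod_self_pos[of "u' - u" n] u u' by fastforce
  then have "(u' - u) + u = u" using u by simp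
  moreover have "(u' - u) + u = u'" using u u' by (intro eq_vecI) auto
  ultimately show "u' = u" by simp
qed

end

section \<open>A basis adapted to nested spaces\<close>

context
  fixes n :: nat
begin

interpretation vec_space "TYPE(real)" n .

definition orthonormal_seq :: "(nat \<Rightarrow> real Matrix.vec) \<Rightarrow> nat \<Rightarrow> bool" where
  "orthonormal_seq e N \<longleftrightarrow> (\<forall>i<N. e i \<in> carrier_vec n) \<and>
     (\<forall>i<N. \<forall>j<N. e i \<bullet> e j = (if i = j then 1 else 0))"

lemma orthonormal_seq_set:
  assumes "orthonormal_seq e N"
  shows "orthonormal_vecs n (e ` {..<N})" "card (e ` {..<N}) = N"
proof -
  have inj: "inj_on e {..<N}"
  proof (rule inj_onI)
    fix i j assume "i \<in> {..<N}" "j \<in> {..<N}" "e i = e j"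
    then show "i = j" using assms unfolding orthonormal_seq_def
      by (metis lessThan_iff zero_neq_one)
  qed
  then show "card (e ` {..<N}) = N" by (simp add: card_image)
  show "orthonormal_vecs n (e ` {..<N})"
    using assms inj by (auto simp: orthonormal_vecs_def orthonormal_seq_def inj_on_def)
qed

lemma orthonormal_seq_extend:
  assumes W: "linear_space_of_dim n N W"
    and e: "orthonormal_seq e j" "\<forall>i<j. e i \<in> W" and j: "j \<le> N"
  shows "\<exists>e'. orthonormal_seq e' N \<and> (\<forall>i<j. e' i = e i) \<and> (\<forall>i<N. e' i \<in> W)"
  using j e
proof (induction j arbitrary: e rule: inc_induct)
  case base
  then show ?case by auto
next
  case (step j)
  have "\<exists>v\<in>W. v \<notin> e ` {..<j} \<and> orthonormal_vecs n (insert v (e ` {..<j}))"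
  proof (rule orthonormal_extend[OF W])
    show "orthonormal_vecs n (e ` {..<j})" "card (e ` {..<j}) < N"
      using orthonormal_seq_set[OF step.prems(1)] step.hyps by auto
    show "e ` {..<j} \<subseteq> W" using step.prems(2) by auto
  qed
  then obtain v where v: "v \<in> W" "v \<notin> e ` {..<j}" "orthonormal_vecs n (insert v (e ` {..<j}))"
    by blast
  let ?e = "e(j := v)"
  have "orthonormal_seq ?e (Suc j)"
    unfolding orthonormal_seq_def
  proof (intro conjI allI impI)
    show "?e i \<in> carrier_vec n" if "i < Suc j" for i
      using that v(3) by (auto simp: orthonormal_vecs_def)
    show "?e i \<bullet> ?e k = (if i = k then 1 else 0)" if "i < Suc j" "k < Suc j" for i k
    proof (cases "i = j \<or> k = j")
      case True then show ?thesis using v(2,3) that unfolding orthonormal_vecs_def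
        by (auto simp: less_Suc_eq)
    next
      case False then show ?thesis using that step.prems(1) by (auto simp: orthonormal_seq_def)
    qed
  qed
  moreover have "\<forall>i<Suc j. ?e i \<in> W" using v step.prems by (auto simp: less_Suc_eq)
  ultimately obtain e' where "orthonormal_seq e' N" "\<forall>i<Suc j. e' i = ?e i" "\<forall>i<N. e' i \<in> W"
    using step.IH by blast
  then show ?case by (intro exI[of _ e']) (auto simp: less_Suc_eq)
qed

lemma proj_orthocomp_exists:
  assumes W: "linear_space_of_dim n N W" and x: "x \<in> carrier_vec n"
  shows "proj_orthocomp n W x \<in> carrier_vec n" "\<And>y. y \<in> W \<Longrightarrow> proj_orthocomp n W x \<bullet> y = 0"
    "x - proj_orthocomp n W x \<in> W"
proof -
  note D = linear_space_of_dimD[OF W]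
  have "orthonormal_seq (\<lambda>_. 0\<^sub>v n) 0" by (auto simp: orthonormal_seq_def)
  from orthonormal_seq_extend[OF W this] obtain e where
    e: "orthonormal_seq e N" "\<forall>i<N. e i \<in> W" by auto
  let ?U = "e ` {..<N}"
  note U = orthonormal_seq_set[OF e(1)]
  have UW: "?U \<subseteq> W" using e by auto
  obtain p where p: "p \<in> carrier_vec n" "p \<in> W" "\<forall>u\<in>?U. (x - p) \<bullet> u = 0"
    using orthogonal_remainder[OF U(1) x, of W] D UW by blast
  have xp: "x - p \<in> carrier_vec n" "x - (x - p) = p" using x p by (auto intro!: eq_vecI)
  have o: "(x - p) \<bullet> y = 0" if "y \<in> W" for y
    using orthogonal_to_maximal_orthonormal[OF W U(1) UW U(2) xp(1) p(3) that] .
  have "proj_orthocomp n W x = x - p"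
    by (rule proj_orthocomp_eqI[OF W x]) (use xp o p in auto)
  then show "proj_orthocomp n W x \<in> carrier_vec n" "\<And>y. y \<in> W \<Longrightarrow> proj_orthocomp n W x \<bullet> y = 0"
    "x - proj_orthocomp n W x \<in> W" using o xp p by auto
qed

text \<open>
  One sequence serves all spaces at once: an orthonormal basis of \<open>W k\<close> is extended to one of
  \<open>W (Suc k)\<close>, and the earlier members stay in the earlier spaces.
\<close>

lemma flag_orthonormal_seq:
  assumes W: "\<And>k. linear_space_of_dim n (N k) (W k)" and nest: "\<And>k. W k \<subseteq> W (Suc k)"
  shows "\<exists>e. orthonormal_seq e (N k) \<and> (\<forall>l\<le>k. N l \<le> N k \<and> (\<forall>i<N l. e i \<in> W l))"
proof (induction k)
  case 0
  have "orthonormal_seq (\<lambda>_. 0\<^sub>v n) 0" by (auto simp: orthonormal_seq_def)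
  from orthonormal_seq_extend[OF W this] show ?case by auto
next
  case (Suc k)
  then obtain e where e: "orthonormal_seq e (N k)" "\<forall>l\<le>k. N l \<le> N k \<and> (\<forall>i<N l. e i \<in> W l)"
    by blast
  have eW: "\<forall>i<N k. e i \<in> W (Suc k)" using e(2) nest[of k] by auto
  have le: "N k \<le> N (Suc k)"
    using orthonormal_card_le_dim[OF W orthonormal_seq_set(1)[OF e(1)], of "Suc k"] eW
      orthonormal_seq_set(2)[OF e(1)] by auto
  from orthonormal_seq_extend[OF W e(1) eW le] obtain e' where
    e': "orthonormal_seq e' (N (Suc k))" "\<forall>i<N k. e' i = e i" "\<forall>i<N (Suc k). e' i \<in> W (Suc k)"
    by auto
  have "N l \<le> N (Suc k) \<and> (\<forall>i<N l. e' i \<in> W l)" if "l \<le> Suc k" for l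
  proof (cases "l = Suc k")
    case True then show ?thesis using e' by auto
  next
    case False
    then have "l \<le> k" using that by simp
    then have "N l \<le> N k" "\<forall>i<N l. e i \<in> W l" using e(2) by auto
    then show ?thesis using e'(2) le by auto
  qed
  then show ?case using e'(1) by blast
qed

end

text \<open>
  Parseval's identity for the columns of an orthogonal matrix.
\<close>

lemma orthogonal_mat_norm:
  fixes Q :: "real Matrix.mat"
  assumes Q: "Q \<in> carrier_mat n n" "transpose_mat Q * Q = 1\<^sub>m n" and x: "x \<in> carrier_vec n"
  shows "(\<Sum>i<n. (Matrix.col Q i \<bullet> x)\<^sup>2) = x \<bullet> x"
proof -
  have QQ: "Q * transpose_mat Q = 1\<^sub>m n"
    using mat_mult_left_right_inverse[of "transpose_mat Q" n Q] Q by auto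
  let ?y = "transpose_mat Q *\<^sub>v x"
  have y: "?y \<in> carrier_vec n" using Q x by auto
  have "(\<Sum>i<n. (Matrix.col Q i \<bullet> x)\<^sup>2) = ?y \<bullet> ?y"
    unfolding scalar_prod_self using Q by (intro sum.cong) (auto simp: carrier_matD)
  also have "\<dots> = x \<bullet> (Q *\<^sub>v ?y)"
    using transpose_vec_mult_scalar[OF Q(1) y x] by simp
  also have "Q *\<^sub>v ?y = (Q * transpose_mat Q) *\<^sub>v x" using Q x by (simp add: assoc_mult_mat_vec)
  finally show ?thesis using QQ x by simp
qed

lemma orthonormal_seq_mat:
  assumes e: "orthonormal_seq n e n"
  defines "Q \<equiv> Matrix.mat n n (\<lambda>(a, i). e i $ a)"
  shows "Q \<in> carrier_mat n n" "transpose_mat Q * Q = 1\<^sub>m n" "\<And>i. i < n \<Longrightarrow> Matrix.col Q i = e i"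
proof -
  show Q: "Q \<in> carrier_mat n n" by (simp add: Q_def)
  show c: "Matrix.col Q i = e i" if "i < n" for i
    using e that unfolding Q_def orthonormal_seq_def by (intro eq_vecI) auto
  show "transpose_mat Q * Q = 1\<^sub>m n"
    using Q c e by (intro eq_matI) (auto simp: orthonormal_seq_def)
qed

text \<open>
  The space in question is spanned by the columns of \<open>Q\<close> with index in \<open>J\<close>.
\<close>

lemma coordinate_space_proj:
  fixes Q :: "real Matrix.mat"
  assumes Q: "Q \<in> carrier_mat n n" "transpose_mat Q * Q = 1\<^sub>m n" and J: "J \<subseteq> {..<n}"
  shows "\<exists>W. linear_space_of_dim n (card J) W \<and>
    (\<forall>x\<in>carrier_vec n. (l2norm (proj_orthocomp n W x))\<^sup>2 = (\<Sum>i\<in>{..<n} - J. (Matrix.col Q i \<bullet> x)\<^sup>2))"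
proof -
  interpret vec_space "TYPE(real)" n .
  let ?e = "Matrix.col Q"
  have on: "?e i \<bullet> ?e j = (if i = j then 1 else 0)" if "i < n" "j < n" for i j
  proof -
    have "Matrix.col Q i \<bullet> Matrix.col Q j = (transpose_mat Q * Q) $$ (i, j)" using that Q(1) by auto
    then show ?thesis using that Q(2) by simp
  qed
  have inj: "inj_on ?e {..<n}" by (rule inj_onI) (metis on lessThan_iff zero_neq_one)
  let ?U = "?e ` J"
  have ec: "?e i \<in> carrier_vec n" for i using Q by auto
  have U: "orthonormal_vecs n ?U" unfolding orthonormal_vecs_def
    using on J inj ec finite_subset[OF J] by (auto simp: subset_iff inj_on_def)
  have cU: "?U \<subseteq> carrier_vec n" using ec by auto
  have cardU: "card ?U = card J" using inj_on_subset[OF inj J] by (rule card_image)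
  have W: "linear_space_of_dim n (card J) (span ?U)"
    using linear_space_span_orthonormal[OF U] cardU by simp
  have "(l2norm (proj_orthocomp n (span ?U) x))\<^sup>2 = (\<Sum>i\<in>{..<n} - J. (?e i \<bullet> x)\<^sup>2)"
    if x: "x \<in> carrier_vec n" for x
  proof -
    note P = proj_orthocomp_exists[OF W x]
    let ?u = "proj_orthocomp n (span ?U) x"
    have perp: "?e i \<bullet> y = 0" if i: "i < n" "i \<notin> J" and y: "y \<in> span ?U" for i y
    proof -
      have "?e i \<in> orthogonal_complement ?U"
        using on[of i] i J ec by (auto simp: orthogonal_complement_def subset_iff split: if_splits)
      then show ?thesis using in_orthogonal_complement_span[OF cU] y
        by (auto simp: orthogonal_complement_def)
    qed
    have "(l2norm ?u)\<^sup>2 = ?u \<bullet> ?u" 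
      by (simp add: l2norm_def scalar_prod_self sum_nonneg)
    also have "\<dots> = (\<Sum>i<n. (?e i \<bullet> ?u)\<^sup>2)" using orthogonal_mat_norm[OF Q P(1)] by simp
    also have "\<dots> = (\<Sum>i\<in>{..<n} - J. (?e i \<bullet> ?u)\<^sup>2)"
    proof (rule sum.mono_neutral_right)
      have "?e i \<bullet> ?u = 0" if "i \<in> J" for i
      proof -
        have "?e i \<in> span ?U" using in_own_span[OF cU] that by auto
        then show ?thesis using P(2) comm_scalar_prod[OF ec P(1)] by metis
      qed
      then show "\<forall>i\<in>{..<n} - ({..<n} - J). (?e i \<bullet> ?u)\<^sup>2 = 0" by auto
    qed auto
    also have "\<dots> = (\<Sum>i\<in>{..<n} - J. (?e i \<bullet> x)\<^sup>2)"
    proof (rule sum.cong[OF refl])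
      fix i assume i: "i \<in> {..<n} - J"
      have "?e i \<bullet> (x - ?u) = 0" using perp P(3) i by auto
      then show "(?e i \<bullet> ?u)\<^sup>2 = (?e i \<bullet> x)\<^sup>2"
        using scalar_prod_minus_distrib[OF ec[of i] x P(1)] by auto
    qed
    finally show ?thesis .
  qed
  with W show ?thesis by blast
qed

text \<open>
  The columns with index at least \<open>q * 2 ^ k\<close> are orthogonal to \<open>V k\<close>, so the coordinates of
  \<open>x\<close> along them are those of its projection on the orthocomplement. If \<open>q * 2 ^ k\<close> exceeds
  \<open>m\<close>, there are no such columns.
\<close>

lemma nested_spaces_basis:
  assumes V: "nested_spaces m q V" and q: "q \<ge> 1"
  obtains Q where "Q \<in> carrier_mat m m" "transpose_mat Q * Q = 1\<^sub>m m"
    "\<And>k x. x \<in> carrier_vec m \<Longrightarrow>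
       (\<Sum>i\<in>{i. q * 2 ^ k \<le> i \<and> i < m}. (Matrix.col Q i \<bullet> x)\<^sup>2) \<le> (l2norm (proj_orthocomp m (V k) x))\<^sup>2"
proof -
  interpret vec_space "TYPE(real)" m .
  define N where "N k = min (q * 2 ^ k) m" for k
  have qm: "q \<le> m"
  proof -
    have W: "linear_space_of_dim m q (V 0)" using V by (simp add: nested_spaces_def)
    have "orthonormal_seq m (\<lambda>_. 0\<^sub>v m) 0" by (auto simp: orthonormal_seq_def)
    from orthonormal_seq_extend[OF W this] obtain e where e: "orthonormal_seq m e q" by auto
    from orthonormal_lin_indpt[OF orthonormal_seq_set(1)[OF e]] orthonormal_seq_set[OF e]
    show ?thesis using li_le_dim(2)[of "e ` {..<q}"] dim_is_n by (auto simp: orthonormal_vecs_def)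
  qed
  have W: "linear_space_of_dim m (N k) (V k)" for k
    using V qm by (cases "k = 0") (auto simp: nested_spaces_def N_def)
  have nest: "V k \<subseteq> V (Suc k)" for k
    using V unfolding nested_spaces_def by (metis Suc_leI diff_Suc_1 zero_less_Suc One_nat_def)
  \<comment> \<open>\<open>V m\<close> is already all of \<open>m\<close>-space\<close>
  have Nm: "N k = m" if "k \<ge> m" for k
  proof -
    have "m \<le> 2 ^ m" by (simp add: less_imp_le)
    also have "\<dots> \<le> 2 ^ k" using that by simp
    also have "\<dots> \<le> q * 2 ^ k" using q by simp
    finally show ?thesis by (simp add: N_def)
  qed
  obtain e where e: "orthonormal_seq m e m" "\<And>l i. l \<le> m \<Longrightarrow> i < N l \<Longrightarrow> e i \<in> V l"
    using flag_orthonormal_seq[of m N V m, OF W nest] Nm[of m] by auto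
  define Q where "Q = Matrix.mat m m (\<lambda>(a, i). e i $ a)"
  note Q = orthonormal_seq_mat[OF e(1), folded Q_def]
  show thesis
  proof (rule that[OF Q(1,2)])
    fix k and x :: "real Matrix.vec" assume x: "x \<in> carrier_vec m"
    let ?S = "{i. q * 2 ^ k \<le> i \<and> i < m}"
    let ?u = "proj_orthocomp m (V k) x"
    note P = proj_orthocomp_exists[OF W[of k] x]
    have ec: "e i \<in> carrier_vec m" if "i < m" for i using e(1) that by (auto simp: orthonormal_seq_def)
    have eq: "Matrix.col Q i \<bullet> x = Matrix.col Q i \<bullet> ?u" if iS: "i \<in> ?S" for i
    proof -
      have km: "k \<le> m"
      proof (rule ccontr)
        assume "\<not> k \<le> m" then show False using Nm[of k] iS by (auto simp: N_def)
      qed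
      have ek: "orthonormal_seq m e (N k)" using e(1) by (auto simp: orthonormal_seq_def N_def)
      have "e i \<bullet> (x - ?u) = 0"
      proof (rule orthogonal_to_maximal_orthonormal[OF W[of k] orthonormal_seq_set(1)[OF ek] _ orthonormal_seq_set(2)[OF ek]])
        show "e ` {..<N k} \<subseteq> V k" using e(2) km by auto
        show "e i \<in> carrier_vec m" using ec iS by auto
        show "\<forall>u\<in>e ` {..<N k}. e i \<bullet> u = 0" using e(1) iS by (auto simp: orthonormal_seq_def N_def)
        show "x - ?u \<in> V k" by (rule P)
      qed
      then show ?thesis using Q(3)[of i] iS scalar_prod_minus_distrib[OF ec[of i] x P(1)] by auto
    qed
    have "(\<Sum>i\<in>?S. (Matrix.col Q i \<bullet> x)\<^sup>2) = (\<Sum>i\<in>?S. (Matrix.col Q i \<bullet> ?u)\<^sup>2)"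
      using eq by (intro sum.cong) auto
    also have "\<dots> \<le> (\<Sum>i<m. (Matrix.col Q i \<bullet> ?u)\<^sup>2)" by (rule sum_mono2) auto
    also have "\<dots> = ?u \<bullet> ?u" by (rule orthogonal_mat_norm[OF Q(1,2) P(1)])
    also have "\<dots> = (l2norm ?u)\<^sup>2" by (simp add: l2norm_def scalar_prod_self sum_nonneg)
    finally show "(\<Sum>i\<in>?S. (Matrix.col Q i \<bullet> x)\<^sup>2) \<le> (l2norm ?u)\<^sup>2" .
  qed
qed

section \<open>Kronecker powers\<close>

lemma sum_div_mod:
  fixes f :: "nat \<Rightarrow> nat \<Rightarrow> 'a::comm_monoid_add"
  shows "(\<Sum>i<m * k. f (i div k) (i mod k)) = (\<Sum>a<m. \<Sum>b<k. f a b)"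
proof -
  have "(\<Sum>i<m * k. f (i div k) (i mod k)) = (\<Sum>(a, b)\<in>{..<m} \<times> {..<k}. f a b)"
  proof (rule sum.reindex_bij_witness[where i = "\<lambda>(a, b). a * k + b" and j = "\<lambda>i. (i div k, i mod k)"])
    fix i assume i: "i \<in> {..<m * k}"
    then have k: "k > 0" by (cases k) auto
    show "(i div k, i mod k) \<in> {..<m} \<times> {..<k}"
      using i k by (auto simp: less_mult_imp_div_less)
  next
    fix p assume p: "p \<in> {..<m} \<times> {..<k}"
    obtain a b where ab: "p = (a, b)" "a < m" "b < k" using p by auto
    have "a * k + b < a * k + k" using ab by simp
    also have "\<dots> = Suc a * k" by simp
    also have "\<dots> \<le> m * k" using ab by (intro mult_le_mono1) simp
    finally show "(case p of (a, b) \<Rightarrow> a * k + b) \<in> {..<m * k}" using ab by simp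
  qed auto
  then show ?thesis by (simp add: sum.cartesian_product)
qed

lemma dim_kron [simp]: "dim_row (kron A B) = dim_row A * dim_row B" "dim_col (kron A B) = dim_col A * dim_col B"
  by (auto simp: kron_def)

lemma dim_tensor_power [simp]:
  "dim_row (tensor_power A d) = dim_row A ^ d" "dim_col (tensor_power A d) = dim_col A ^ d"
  by (induction d) auto

lemma index_kron:
  assumes "i < dim_row A * dim_row B" "j < dim_col A * dim_col B"
  shows "kron A B $$ (i, j) = A $$ (i div dim_row B, j div dim_col B) * B $$ (i mod dim_row B, j mod dim_col B)"
  using assms by (simp add: kron_def)

lemma div_mod_bounds:
  fixes i :: nat
  assumes "i < m * k"
  shows "i div k < m" "i mod k < k"
proof -
  have "k > 0" using assms by (cases k) auto
  then show "i div k < m" "i mod k < k" using assms by (auto simp: less_mult_imp_div_less)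
qed

text \<open>
  The mixed product rule.
\<close>

lemma kron_mult:
  assumes "dim_col A = dim_row B" "dim_col C = dim_row D"
  shows "kron (A * B) (C * D) = kron A C * kron B D"
proof (rule eq_matI)
  fix i j assume "i < dim_row (kron A C * kron B D)" "j < dim_col (kron A C * kron B D)"
  then have i: "i < dim_row A * dim_row C" and j: "j < dim_col B * dim_col D" by auto
  note ib = div_mod_bounds[OF i] and jb = div_mod_bounds[OF j]
  let ?i1 = "i div dim_row C" and ?i2 = "i mod dim_row C" and ?j1 = "j div dim_col D" and ?j2 = "j mod dim_col D"
  have "(kron A C * kron B D) $$ (i, j) = (\<Sum>l<dim_row B * dim_row D. kron A C $$ (i, l) * kron B D $$ (l, j))"
    using i j assms by (simp add: scalar_prod_def lessThan_atLeast0)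
  also have "\<dots> = (\<Sum>l<dim_row B * dim_row D. (A $$ (?i1, l div dim_row D) * B $$ (l div dim_row D, ?j1))
       * (C $$ (?i2, l mod dim_row D) * D $$ (l mod dim_row D, ?j2)))"
    using i j assms by (intro sum.cong) (auto simp: index_kron mult_ac)
  also have "\<dots> = (\<Sum>a<dim_row B. \<Sum>b<dim_row D. (A $$ (?i1, a) * B $$ (a, ?j1)) * (C $$ (?i2, b) * D $$ (b, ?j2)))"
    by (rule sum_div_mod)
  also have "\<dots> = (A * B) $$ (?i1, ?j1) * (C * D) $$ (?i2, ?j2)"
    using ib jb assms by (simp add: scalar_prod_def lessThan_atLeast0 sum_product)
  also have "\<dots> = kron (A * B) (C * D) $$ (i, j)" using i j by (simp add: index_kron)
  finally show "kron (A * B) (C * D) $$ (i, j) = (kron A C * kron B D) $$ (i, j)" by simp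
qed auto

lemma tensor_power_mult:
  assumes "dim_col A = dim_row B"
  shows "tensor_power (A * B) d = tensor_power A d * tensor_power B d"
  using assms by (induction d) (auto simp: kron_mult)

lemma tensor_power_transpose: "tensor_power (transpose_mat A) d = transpose_mat (tensor_power A d)"
proof (induction d)
  case (Suc d)
  show ?case unfolding tensor_power.simps Suc
    by (rule eq_matI) (auto simp: index_kron div_mod_bounds)
qed simp

lemma tensor_power_one: "tensor_power (1\<^sub>m m) d = 1\<^sub>m (m ^ d)"
proof (induction d)
  case (Suc d)
  show ?case unfolding tensor_power.simps Suc
  proof (rule eq_matI)
    fix i j assume "i < dim_row (1\<^sub>m (m ^ Suc d) :: real Matrix.mat)" "j < dim_col (1\<^sub>m (m ^ Suc d) :: real Matrix.mat)"
    then have ij: "i < m * m ^ d" "j < m * m ^ d" by auto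
    have "i = j \<longleftrightarrow> i div m ^ d = j div m ^ d \<and> i mod m ^ d = j mod m ^ d"
      by (metis div_mult_mod_eq)
    then show "kron (1\<^sub>m m) (1\<^sub>m (m ^ d)) $$ (i, j) = (1\<^sub>m (m ^ Suc d) :: real Matrix.mat) $$ (i, j)"
      using ij div_mod_bounds[OF ij(1)] div_mod_bounds[OF ij(2)] by (auto simp: index_kron)
  qed auto
qed simp

lemma orthogonal_tensor_power:
  assumes "Q \<in> carrier_mat m m" "transpose_mat Q * Q = 1\<^sub>m m"
  shows "tensor_power Q d \<in> carrier_mat (m ^ d) (m ^ d)"
    "transpose_mat (tensor_power Q d) * tensor_power Q d = 1\<^sub>m (m ^ d)"
  using assms by (auto simp: tensor_power_transpose[symmetric] tensor_power_mult[symmetric] tensor_power_one)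

section \<open>The hyperbolic cross\<close>

primrec tensor_level :: "(nat \<Rightarrow> nat) \<Rightarrow> nat \<Rightarrow> nat \<Rightarrow> nat \<Rightarrow> nat" where
  "tensor_level lev m 0 i = 0"
| "tensor_level lev m (Suc d) i = lev (i div m ^ d) + tensor_level lev m d (i mod m ^ d)"

text \<open>
  The number of ways to write \<open>s\<close> as an ordered sum of \<open>d\<close> natural numbers.
\<close>

primrec weak_compositions :: "nat \<Rightarrow> nat \<Rightarrow> nat" where
  "weak_compositions 0 s = (if s = 0 then 1 else 0)"
| "weak_compositions (Suc d) s = (\<Sum>t\<le>s. weak_compositions d t)"

lemma weak_compositions_le: "weak_compositions (Suc d) s \<le> Suc s ^ d"
proof (induction d arbitrary: s)
  case (Suc d)
  have "weak_compositions (Suc (Suc d)) s = (\<Sum>t\<le>s. weak_compositions (Suc d) t)" by simp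
  also have "\<dots> \<le> (\<Sum>t\<le>s. Suc s ^ d)"
    by (intro sum_mono order_trans[OF Suc] power_mono) auto
  finally show ?case by simp
qed (simp add: sum.delta)

text \<open>
  The generating function of the squared entries by level is multiplicative under the Kronecker
  product, and \<open>x ^ (s - t) * x ^ t\<close> does not depend on \<open>t\<close>; what remains is the number of ways
  to distribute \<open>s\<close>. With \<open>x < 1\<close> this bounds energies, and for a matrix of ones with \<open>x = 2\<close>
  it counts indices.
\<close>

lemma tensor_level_mass:
  fixes A :: "real Matrix.mat"
  assumes B: "B \<ge> 0" and x: "x \<ge> 0"
    and A: "\<And>j k. j < dim_col A \<Longrightarrow> (\<Sum>i<dim_row A. if lev i = k then (A $$ (i, j))\<^sup>2 else 0) \<le> B * x ^ k"
    and j: "j < dim_col A ^ d"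
  shows "(\<Sum>i<dim_row A ^ d. if tensor_level lev (dim_row A) d i = s then (tensor_power A d $$ (i, j))\<^sup>2 else 0)
    \<le> B ^ d * x ^ s * weak_compositions d s"
  using j
proof (induction d arbitrary: j s)
  case 0
  then show ?case by simp
next
  case (Suc d)
  let ?m = "dim_row A" and ?M = "dim_row A ^ d"
  let ?j1 = "j div dim_col A ^ d" and ?j2 = "j mod dim_col A ^ d"
  have j: "j < dim_col A * dim_col A ^ d" using Suc.prems by simp
  note jb = div_mod_bounds[OF j]
  let ?u = "\<lambda>k a. if lev a = k then (A $$ (a, ?j1))\<^sup>2 else 0"
  let ?w = "\<lambda>k b. if tensor_level lev ?m d b = k then (tensor_power A d $$ (b, ?j2))\<^sup>2 else 0"
  have split: "(if k + l = s then y * z else 0) = (\<Sum>t\<le>s. (if k = s - t then y else 0) * (if l = t then z else 0))"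
    for k l and y z :: real
  proof -
    have "(\<Sum>t\<le>s. (if k = s - t then y else 0) * (if l = t then z else 0))
       = (\<Sum>t\<le>s. if t = l then (if k + l = s then y * z else 0) else 0)"
      by (intro sum.cong) auto
    then show ?thesis by auto
  qed
  have "(\<Sum>i<?m ^ Suc d. if tensor_level lev ?m (Suc d) i = s then (tensor_power A (Suc d) $$ (i, j))\<^sup>2 else 0)
     = (\<Sum>i<?m * ?M. (\<lambda>a b. if lev a + tensor_level lev ?m d b = s
          then (A $$ (a, ?j1))\<^sup>2 * (tensor_power A d $$ (b, ?j2))\<^sup>2 else 0) (i div ?M) (i mod ?M))"
    using j by (intro sum.cong) (auto simp: index_kron power_mult_distrib)
  also have "\<dots> = (\<Sum>a<?m. \<Sum>b<?M. if lev a + tensor_level lev ?m d b = s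
          then (A $$ (a, ?j1))\<^sup>2 * (tensor_power A d $$ (b, ?j2))\<^sup>2 else 0)"
    by (rule sum_div_mod)
  also have "\<dots> = (\<Sum>a<?m. \<Sum>b<?M. \<Sum>t\<le>s. ?u (s - t) a * ?w t b)"
    by (simp only: split)
  also have "\<dots> = (\<Sum>a<?m. \<Sum>t\<le>s. \<Sum>b<?M. ?u (s - t) a * ?w t b)"
    by (intro sum.cong refl sum.swap)
  also have "\<dots> = (\<Sum>t\<le>s. \<Sum>a<?m. \<Sum>b<?M. ?u (s - t) a * ?w t b)"
    by (rule sum.swap)
  also have "\<dots> = (\<Sum>t\<le>s. (\<Sum>a<?m. ?u (s - t) a) * (\<Sum>b<?M. ?w t b))"
    by (simp only: sum_product)
  also have "\<dots> \<le> (\<Sum>t\<le>s. (B * x ^ (s - t)) * (B ^ d * x ^ t * weak_compositions d t))"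
    using Suc.IH[OF jb(2)] A[OF jb(1)] B x by (intro sum_mono mult_mono sum_nonneg) auto
  also have "\<dots> = (\<Sum>t\<le>s. B ^ Suc d * x ^ s * weak_compositions d t)"
  proof (rule sum.cong[OF refl])
    fix t assume "t \<in> {..s}"
    then have "x ^ (s - t) * x ^ t = x ^ s" by (simp add: power_add[symmetric])
    then show "(B * x ^ (s - t)) * (B ^ d * x ^ t * weak_compositions d t) = B ^ Suc d * x ^ s * weak_compositions d t"
      by (simp add: mult_ac)
  qed
  also have "\<dots> = B ^ Suc d * x ^ s * weak_compositions (Suc d) s"
    by (simp add: sum_distrib_left)
  finally show ?case .
qed

text \<open>
  By \<open>Suc (K + t) \<le> Suc K * Suc t\<close>, the tail is at most its leading factor times the whole
  series.
\<close>

lemma polynomial_geometric_tail: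
  fixes x :: real
  assumes "0 < x" "x < 1"
  shows "\<exists>C\<ge>1. \<forall>K M. (\<Sum>s\<in>{K<..M}. real (Suc s ^ e) * x ^ s) \<le> C * real (Suc K ^ e) * x ^ K"
proof -
  have sm: "summable (\<lambda>t. real (Suc t ^ e) * x ^ t)"
  proof (rule summable_comparison_test_bigo)
    show "summable (\<lambda>t. norm (sqrt x ^ t))" using assms by (simp add: summable_geometric)
    define c where "c = ln x / 2"
    have "c < 0" using assms by (simp add: c_def)
    then have "(\<lambda>t::nat. (real t + 1) powr real e * exp (2 * c * real t)) \<in> O(\<lambda>t. exp (c * real t))"
      by real_asymp
    moreover have "(real t + 1) powr real e * exp (2 * c * real t) = real (Suc t ^ e) * x ^ t" for t
      using assms by (simp add: c_def powr_realpow exp_of_nat2_mult add.commute)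
    moreover have "exp (c * real t) = sqrt x ^ t" for t
    proof -
      have "exp c = sqrt x" using assms by (simp add: c_def ln_sqrt[symmetric])
      then show ?thesis by (simp only: exp_of_nat2_mult)
    qed
    ultimately show "(\<lambda>t. real (Suc t ^ e) * x ^ t) \<in> O(\<lambda>t. sqrt x ^ t)" by simp
  qed
  define C where "C = (\<Sum>t. real (Suc t ^ e) * x ^ t)"
  have part: "(\<Sum>t<n. real (Suc t ^ e) * x ^ t) \<le> C" for n
    unfolding C_def using assms by (intro sum_le_suminf[OF sm]) auto
  have C1: "C \<ge> 1" using part[of 1] by simp
  have "(\<Sum>s\<in>{K<..M}. real (Suc s ^ e) * x ^ s) \<le> C * real (Suc K ^ e) * x ^ K" for K M
  proof -
    have "(\<Sum>s\<in>{K<..M}. real (Suc s ^ e) * x ^ s) \<le> (\<Sum>s\<in>{K..<K + Suc M}. real (Suc s ^ e) * x ^ s)"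
      using assms by (intro sum_mono2) auto
    also have "\<dots> = (\<Sum>t<Suc M. real (Suc (K + t) ^ e) * x ^ (K + t))"
      by (rule sum.reindex_bij_witness[where i = "\<lambda>t. K + t" and j = "\<lambda>s. s - K"]) auto
    also have "\<dots> \<le> (\<Sum>t<Suc M. real (Suc K ^ e) * x ^ K * (real (Suc t ^ e) * x ^ t))"
    proof (rule sum_mono)
      fix t
      have "Suc (K + t) \<le> Suc K * Suc t" by simp
      then have "Suc (K + t) ^ e \<le> Suc K ^ e * Suc t ^ e"
        by (metis power_mono power_mult_distrib zero_le)
      then have "real (Suc (K + t) ^ e) \<le> real (Suc K ^ e * Suc t ^ e)" by (rule of_nat_mono)
      then have "real (Suc (K + t) ^ e) * x ^ (K + t) \<le> real (Suc K ^ e * Suc t ^ e) * x ^ (K + t)"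
        using assms by (intro mult_right_mono) auto
      then show "real (Suc (K + t) ^ e) * x ^ (K + t) \<le> real (Suc K ^ e) * x ^ K * (real (Suc t ^ e) * x ^ t)"
        by (simp add: power_add mult_ac)
    qed
    also have "\<dots> = real (Suc K ^ e) * x ^ K * (\<Sum>t<Suc M. real (Suc t ^ e) * x ^ t)"
      by (rule sum_distrib_left[symmetric])
    also have "\<dots> \<le> real (Suc K ^ e) * x ^ K * C"
      using assms by (intro mult_left_mono part) auto
    finally show ?thesis by (simp add: mult_ac)
  qed
  then show ?thesis using C1 by blast
qed

text \<open>
  What the approximation and the entropy bounds need of the tensor structure: in the
  orthonormal basis given by the columns of \<open>Q\<close>, the coordinate sets \<open>J K\<close> carry the columns of
  \<open>X\<close> up to the stated squared error.
\<close>

definition cross_basis :: "real Matrix.mat \<Rightarrow> nat \<Rightarrow> real \<Rightarrow> real \<Rightarrow> real Matrix.mat \<Rightarrow> (nat \<Rightarrow> nat set) \<Rightarrow> bool" where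
  "cross_basis X e W C Q J \<longleftrightarrow> Q \<in> carrier_mat (dim_row X) (dim_row X) \<and> transpose_mat Q * Q = 1\<^sub>m (dim_row X) \<and>
     (\<forall>K. J K \<noteq> {} \<and> J K \<subseteq> {..<dim_row X} \<and> real (card (J K)) \<le> C * real (Suc K ^ e) * 2 ^ K \<and>
        (\<forall>j<dim_col X. (\<Sum>i\<in>{..<dim_row X} - J K. (Matrix.col Q i \<bullet> Matrix.col X j)\<^sup>2)
            \<le> C * real (Suc K ^ e) * 2 powr (- 2 * real K / W)))"

text \<open>
  The constant depends on \<open>d\<close>, \<open>q\<close>, \<open>\<gamma>\<close> and \<open>W\<close> but not on \<open>\<Psi>\<close>, which makes all later
  bounds uniform over the family.
\<close>

lemma hyperbolic_cross:
  fixes \<gamma> W :: real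
  assumes d: "d \<ge> 1" and q: "q \<ge> 1" and \<gamma>: "\<gamma> > 0" and W: "W > 0"
  shows "\<exists>C\<ge>1. \<forall>\<Psi> V. dim_row \<Psi> \<ge> 1 \<and> (\<forall>j<dim_col \<Psi>. l2norm (Matrix.col \<Psi> j) \<le> 1)
      \<and> nested_approximations \<Psi> q \<gamma> W V \<longrightarrow>
    (\<exists>Q J. cross_basis (tensor_power \<Psi> d) (d - 1) W C Q J)"
proof -
  obtain d' where d': "d = Suc d'" using d by (cases d) auto
  define x :: real where "x = 2 powr (- 2 / W)"
  have x: "0 < x" "x < 1" using W by (auto simp: x_def powr_less_one)
  have xk: "x ^ k = 2 powr (- 2 * real k / W)" for k
    using x by (simp add: x_def powr_realpow[symmetric] powr_powr)
  obtain C0 where C0: "C0 \<ge> 1" "\<And>K M. (\<Sum>s\<in>{K<..M}. real (Suc s ^ d') * x ^ s) \<le> C0 * real (Suc K ^ d') * x ^ K"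
    using polynomial_geometric_tail[OF x] by blast
  \<comment> \<open>The given error bounds start at \<open>V 1\<close>, so they concern the levels from 2 on and are late by
    one factor \<open>x\<close>. On the levels 0 and 1 the norm of the column is used.\<close>
  define B where "B = max 1 (\<gamma>\<^sup>2) / x"
  have B: "B \<ge> 1" "B * x \<ge> 1" "B * x \<ge> \<gamma>\<^sup>2" using x by (auto simp: B_def field_simps)
  define C where "C = max (2 * real q ^ d) (B ^ d * C0)"
  have C: "C \<ge> 2 * real q ^ d" "C \<ge> B ^ d * C0" by (auto simp: C_def)
  have "real q ^ d \<ge> 1" using q by (simp add: one_le_power)
  then have C1: "C \<ge> 1" using C(1) by simp
  show ?thesis
  proof (intro exI[of _ C] conjI C1 allI impI, elim conjE)
    fix \<Psi> V
    assume m1: "dim_row \<Psi> \<ge> 1" and col: "\<forall>j<dim_col \<Psi>. l2norm (Matrix.col \<Psi> j) \<le> 1"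
      and nest: "nested_approximations \<Psi> q \<gamma> W V"
    define m where "m = dim_row \<Psi>"
    define n where "n = m ^ d"
    obtain R where R: "R \<in> carrier_mat m m" "transpose_mat R * R = 1\<^sub>m m"
      "\<And>k x. x \<in> carrier_vec m \<Longrightarrow>
       (\<Sum>i\<in>{i. q * 2 ^ k \<le> i \<and> i < m}. (Matrix.col R i \<bullet> x)\<^sup>2) \<le> (l2norm (proj_orthocomp m (V k) x))\<^sup>2"
      using nested_spaces_basis[of m q V] nest q by (auto simp: nested_approximations_def m_def)
    define A where "A = transpose_mat R * \<Psi>"
    have dA: "dim_row A = m" "dim_col A = dim_col \<Psi>" using R by (auto simp: A_def)
    have Aij: "A $$ (i, j) = Matrix.col R i \<bullet> Matrix.col \<Psi> j" if "i < m" "j < dim_col \<Psi>" for i j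
      using that R by (auto simp: A_def)
    \<comment> \<open>the basis vectors with index below \<open>q * 2 ^ k\<close> are those of level at most \<open>k\<close>\<close>
    define lev where "lev i = (LEAST k. i < q * 2 ^ k)" for i
    have lev_ex: "i < q * 2 ^ i" for i
    proof -
      have "i < 2 ^ i" by simp
      also have "\<dots> \<le> q * 2 ^ i" using q by simp
      finally show ?thesis .
    qed
    have lev1: "i < q * 2 ^ lev i" for i unfolding lev_def by (rule LeastI[where P = "\<lambda>k. i < q * 2 ^ k", OF lev_ex])
    have lev2: "q * 2 ^ k \<le> i" if "k < lev i" for i k
      using not_less_Least[of k "\<lambda>k. i < q * 2 ^ k"] that unfolding lev_def by simp
    have energy: "(\<Sum>i<dim_row A. if lev i = k then (A $$ (i, j))\<^sup>2 else 0) \<le> B * x ^ k"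
      if j: "j < dim_col A" for j k
    proof -
      let ?c = "Matrix.col \<Psi> j"
      have c: "?c \<in> carrier_vec m" by (auto simp: m_def)
      have j': "j < dim_col \<Psi>" using j dA by simp
      have e: "(\<Sum>i<dim_row A. if lev i = k then (A $$ (i, j))\<^sup>2 else 0)
          = (\<Sum>i\<in>{i. lev i = k \<and> i < m}. (Matrix.col R i \<bullet> ?c)\<^sup>2)"
        unfolding dA using j' Aij by (simp add: sum.If_cases) (intro sum.cong, auto)
      show ?thesis
      proof (cases "k \<le> 1")
        case True
        have "(\<Sum>i\<in>{i. lev i = k \<and> i < m}. (Matrix.col R i \<bullet> ?c)\<^sup>2) \<le> (\<Sum>i<m. (Matrix.col R i \<bullet> ?c)\<^sup>2)"
          by (intro sum_mono2) auto
        also have "\<dots> = ?c \<bullet> ?c" by (rule orthogonal_mat_norm[OF R(1,2) c])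
        also have "\<dots> = (l2norm ?c)\<^sup>2" by (simp add: l2norm_def scalar_prod_self sum_nonneg)
        also have "\<dots> \<le> 1\<^sup>2" using col j' by (intro power_mono) (auto simp: l2norm_def scalar_prod_self sum_nonneg)
        also have "\<dots> \<le> B * x ^ k" using True B x by (cases k) auto
        finally show ?thesis using e by simp
      next
        case False
        then obtain l where l: "k = Suc l" "l \<ge> 1" by (cases k) auto
        let ?p = "l2norm (proj_orthocomp m (V l) ?c)"
        have "(\<Sum>i\<in>{i. lev i = k \<and> i < m}. (Matrix.col R i \<bullet> ?c)\<^sup>2)
            \<le> (\<Sum>i\<in>{i. q * 2 ^ l \<le> i \<and> i < m}. (Matrix.col R i \<bullet> ?c)\<^sup>2)"
          using l lev2 by (intro sum_mono2) auto
        also have "\<dots> \<le> ?p\<^sup>2" by (rule R(3)[OF c])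
        also have "\<dots> \<le> (\<gamma> * 2 powr (- real l / W))\<^sup>2"
        proof (rule power_mono)
          have "?p \<le> approx_err (V l) \<Psi>" unfolding approx_err_def m_def
            by (rule Max_ge) (use j' in auto)
          also have "\<dots> \<le> \<gamma> * 2 powr (- real l / W)"
            using nest l by (auto simp: nested_approximations_def)
          finally show "?p \<le> \<gamma> * 2 powr (- real l / W)" .
        qed (simp add: l2norm_def scalar_prod_self sum_nonneg)
        also have "\<dots> = \<gamma>\<^sup>2 * x ^ l"
        proof -
          have "(2 powr (- real l / W))\<^sup>2 = (2::real) powr (- 2 * real l / W)"
            by (simp add: power2_eq_square powr_add[symmetric] field_simps)
          then show ?thesis by (simp add: power_mult_distrib xk)
        qed
        also have "\<dots> \<le> (B * x) * x ^ l" using B(3) x by (intro mult_right_mono) auto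
        finally show ?thesis using e l by (simp add: mult_ac)
      qed
    qed
    have count: "(\<Sum>i<m. if lev i = k then 1 else 0) \<le> real q * 2 ^ k" for k
    proof -
      have "(\<Sum>i<m. if lev i = k then 1 else (0::real)) = real (card {i. lev i = k \<and> i < m})"
        by (simp add: sum.If_cases Int_def conj_commute)
      also have "\<dots> \<le> real (card {..<q * 2 ^ k})"
        using lev1 by (intro of_nat_mono card_mono) auto
      finally show ?thesis by simp
    qed
    \<comment> \<open>counting is the case of \<open>tensor_level_mass\<close> in which all entries are 1\<close>
    define U where "U = Matrix.mat m 1 (\<lambda>_. 1 :: real)"
    have dU: "dim_row U = m" "dim_col U = 1" by (auto simp: U_def)
    have U1: "tensor_power U e $$ (i, 0) = 1" if "i < m ^ e" for i e
      using that by (induction e arbitrary: i) (auto simp: index_kron dU div_mod_bounds, auto simp: U_def div_mod_bounds)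
    let ?tl = "tensor_level lev m d"
    let ?T = "tensor_power A d"
    have tcount: "(\<Sum>i<n. if ?tl i = s then 1 else (0::real)) \<le> real q ^ d * 2 ^ s * real (Suc s ^ d')" for s
    proof -
      have "(\<Sum>i<dim_row U. if lev i = k then (U $$ (i, j))\<^sup>2 else 0) = (\<Sum>i<m. if lev i = k then 1 else 0)"
        if "j < dim_col U" for j k
        unfolding dU using that by (intro sum.cong) (auto simp: U_def)
      then have "(\<Sum>i<dim_row U ^ d. if tensor_level lev (dim_row U) d i = s then (tensor_power U d $$ (i, 0))\<^sup>2 else 0)
          \<le> real q ^ d * 2 ^ s * weak_compositions d s"
        using tensor_level_mass[of "real q" 2 U lev 0 d s] count by (auto simp: dU)
      moreover have "(\<Sum>i<dim_row U ^ d. if tensor_level lev (dim_row U) d i = s then (tensor_power U d $$ (i, 0))\<^sup>2 else 0)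
          = (\<Sum>i<n. if ?tl i = s then 1 else (0::real))"
        unfolding dU n_def using U1 by (intro sum.cong) auto
      ultimately have "(\<Sum>i<n. if ?tl i = s then 1 else (0::real)) \<le> real q ^ d * 2 ^ s * weak_compositions d s" by simp
      also have "\<dots> \<le> real q ^ d * 2 ^ s * real (Suc s ^ d')"
        unfolding d' by (intro mult_left_mono of_nat_mono weak_compositions_le) auto
      finally show ?thesis .
    qed
    have tenergy: "(\<Sum>i<n. if ?tl i = s then (?T $$ (i, j))\<^sup>2 else 0) \<le> B ^ d * (x ^ s * real (Suc s ^ d'))"
      if j: "j < dim_col \<Psi> ^ d" for s j
    proof -
      have "(\<Sum>i<n. if ?tl i = s then (?T $$ (i, j))\<^sup>2 else 0) \<le> B ^ d * x ^ s * weak_compositions d s"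
        using tensor_level_mass[of B x A lev j d s] energy B x j by (auto simp: dA n_def)
      also have "\<dots> \<le> B ^ d * x ^ s * real (Suc s ^ d')"
        unfolding d' using B x by (intro mult_left_mono of_nat_mono weak_compositions_le) auto
      finally show ?thesis by (simp add: mult_ac)
    qed
    define Q where "Q = tensor_power R d"
    note O = orthogonal_tensor_power[OF R(1,2), of d, folded Q_def n_def]
    have QT: "Matrix.col Q i \<bullet> Matrix.col (tensor_power \<Psi> d) j = ?T $$ (i, j)"
      if "i < n" "j < dim_col \<Psi> ^ d" for i j
    proof -
      have "?T = transpose_mat Q * tensor_power \<Psi> d"
        unfolding A_def Q_def tensor_power_transpose[symmetric]
        by (rule tensor_power_mult) (use R m_def in auto)
      then show ?thesis using that O by auto
    qed
    define J where "J K = {i. i < n \<and> ?tl i \<le> K}" for K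
    have zero: "?tl 0 = 0" 
    proof -
      have "lev 0 = 0" unfolding lev_def using q by (intro Least_eq_0) simp
      then have "tensor_level lev m e 0 = 0" for e by (induction e) auto
      then show ?thesis .
    qed
    have "n > 0" using m1 by (simp add: n_def m_def)
    show "\<exists>Q J. cross_basis (tensor_power \<Psi> d) (d - 1) W C Q J"
      unfolding cross_basis_def dim_tensor_power m_def[symmetric] n_def[symmetric]
    proof (intro exI[of _ Q] exI[of _ J] conjI allI impI O)
      fix K
      show "J K \<noteq> {}" using \<open>n > 0\<close> zero by (auto simp: J_def intro!: exI[of _ 0])
      show "J K \<subseteq> {..<n}" by (auto simp: J_def)
      have "real (card (J K)) = (\<Sum>i<n. if ?tl i \<le> K then 1 else 0)"
        by (simp add: J_def sum.If_cases Int_def)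
      also have "\<dots> = (\<Sum>i<n. \<Sum>s\<le>K. if ?tl i = s then 1 else 0)"
        by (intro sum.cong) auto
      also have "\<dots> = (\<Sum>s\<le>K. \<Sum>i<n. if ?tl i = s then 1 else 0)" by (rule sum.swap)
      also have "\<dots> \<le> (\<Sum>s\<le>K. real q ^ d * 2 ^ s * real (Suc s ^ d'))" by (intro sum_mono tcount)
      also have "\<dots> \<le> (\<Sum>s\<le>K. real q ^ d * 2 ^ s * real (Suc K ^ d'))"
        by (intro sum_mono mult_left_mono of_nat_mono power_mono) auto
      also have "\<dots> = real q ^ d * real (Suc K ^ d') * (\<Sum>s\<le>K. 2 ^ s)"
        by (simp add: sum_distrib_left sum_distrib_right mult_ac)
      also have "(\<Sum>s\<le>K. (2::real) ^ s) \<le> 2 * 2 ^ K" by (induction K) auto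
      also have "real q ^ d * real (Suc K ^ d') * (2 * 2 ^ K) \<le> C * real (Suc K ^ d') * 2 ^ K"
        using C(1) by (simp add: mult_right_mono mult_ac)
      finally show "real (card (J K)) \<le> C * real (Suc K ^ (d - 1)) * 2 ^ K"
        by (simp add: d' mult_left_mono)
    next
      fix K j assume j: "j < dim_col \<Psi> ^ d"
      define M where "M = Max (?tl ` {..<n})"
      have M: "?tl i \<le> M" if "i < n" for i unfolding M_def using that by (intro Max_ge) auto
      have "(\<Sum>i\<in>{..<n} - J K. (Matrix.col Q i \<bullet> Matrix.col (tensor_power \<Psi> d) j)\<^sup>2)
          = (\<Sum>i\<in>{..<n} - J K. \<Sum>s\<in>{K<..M}. if ?tl i = s then (?T $$ (i, j))\<^sup>2 else 0)"
        using M QT j by (intro sum.cong) (auto simp: J_def)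
      also have "\<dots> \<le> (\<Sum>i<n. \<Sum>s\<in>{K<..M}. if ?tl i = s then (?T $$ (i, j))\<^sup>2 else 0)"
        by (intro sum_mono2 sum_nonneg) auto
      also have "\<dots> = (\<Sum>s\<in>{K<..M}. \<Sum>i<n. if ?tl i = s then (?T $$ (i, j))\<^sup>2 else 0)" by (rule sum.swap)
      also have "\<dots> \<le> (\<Sum>s\<in>{K<..M}. B ^ d * (x ^ s * real (Suc s ^ d')))" by (intro sum_mono tenergy j)
      also have "\<dots> = B ^ d * (\<Sum>s\<in>{K<..M}. real (Suc s ^ d') * x ^ s)"
        by (simp only: sum_distrib_left mult.commute)
      also have "\<dots> \<le> B ^ d * (C0 * real (Suc K ^ d') * x ^ K)" using C0(2) B by (intro mult_left_mono) auto
      also have "\<dots> = (B ^ d * C0) * (real (Suc K ^ d') * x ^ K)" by simp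
      also have "\<dots> \<le> C * (real (Suc K ^ d') * x ^ K)" using C(2) x by (intro mult_right_mono) auto
      finally show "(\<Sum>i\<in>{..<n} - J K. (Matrix.col Q i \<bullet> Matrix.col (tensor_power \<Psi> d) j)\<^sup>2)
          \<le> C * real (Suc K ^ (d - 1)) * 2 powr (- 2 * real K / W)"
        by (simp add: d' xk mult_ac)
    qed
  qed
qed

section \<open>Covers of balls in coordinates\<close>

text \<open>
  Vectors are functions of which only the values on \<open>I\<close> matter, so that restricting to a
  set of coordinates needs no change of type. The size is bounded by a real number because the
  bounds are exponentials.
\<close>

definition covered_by :: "'a set \<Rightarrow> ('a \<Rightarrow> real) set \<Rightarrow> real \<Rightarrow> real \<Rightarrow> bool" where
  "covered_by I F \<rho> N \<longleftrightarrow> (\<exists>C. finite C \<and> real (card C) \<le> N \<and>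
      (\<forall>x\<in>F. \<exists>c\<in>C. L2_set (\<lambda>i. x i - c i) I \<le> \<rho>))"

lemma sum_power_half_abs_le:
  "(\<Sum>k\<in>{- int n..int n}. (1 / 2 :: real) ^ nat \<bar>k\<bar>) \<le> 3"
proof -
  have "(\<Sum>k\<in>{- int n..int n}. (1 / 2 :: real) ^ nat \<bar>k\<bar>) = 3 - 2 * (1 / 2) ^ n"
  proof (induction n)
    case (Suc n)
    have "{- int (Suc n)..int (Suc n)} = insert (- int (Suc n)) (insert (int (Suc n)) {- int n..int n})"
      by auto
    then show ?case using Suc by (simp add: nat_add_distrib)
  qed simp
  then show ?thesis by simp
qed

text \<open>
  Every point with l1-norm at most \<open>n\<close> has weight at least 1 if \<open>z\<close> is weighted by 2 to the power
  \<open>n\<close> minus its l1-norm, and the total weight factorises over the coordinates.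
\<close>

lemma card_small_integer_points:
  assumes J: "finite J"
  shows "finite {z \<in> J \<rightarrow>\<^sub>E {- int n..int n}. (\<Sum>j\<in>J. nat \<bar>z j\<bar>) \<le> n}"
    "real (card {z \<in> J \<rightarrow>\<^sub>E {- int n..int n}. (\<Sum>j\<in>J. nat \<bar>z j\<bar>) \<le> n}) \<le> 2 ^ n * 3 ^ card J"
proof -
  let ?P = "J \<rightarrow>\<^sub>E {- int n..int n}"
  let ?Z = "{z \<in> ?P. (\<Sum>j\<in>J. nat \<bar>z j\<bar>) \<le> n}"
  have finP: "finite ?P" using J by (intro finite_PiE) auto
  then show "finite ?Z" by auto
  have "real (card ?Z) = (\<Sum>z\<in>?Z. 1)" by simp
  also have "\<dots> \<le> (\<Sum>z\<in>?Z. 2 ^ n * (\<Prod>j\<in>J. (1 / 2 :: real) ^ nat \<bar>z j\<bar>))"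
  proof (rule sum_mono)
    fix z assume z: "z \<in> ?Z"
    have "(1::real) = 2 ^ n * (1 / 2) ^ n" by (simp add: power_divide)
    also have "\<dots> \<le> 2 ^ n * (1 / 2) ^ (\<Sum>j\<in>J. nat \<bar>z j\<bar>)"
      using z by (intro mult_left_mono power_decreasing) auto
    also have "\<dots> = 2 ^ n * (\<Prod>j\<in>J. (1 / 2) ^ nat \<bar>z j\<bar>)" by (simp add: power_sum)
    finally show "1 \<le> 2 ^ n * (\<Prod>j\<in>J. (1 / 2 :: real) ^ nat \<bar>z j\<bar>)" .
  qed
  also have "\<dots> \<le> (\<Sum>z\<in>?P. 2 ^ n * (\<Prod>j\<in>J. (1 / 2 :: real) ^ nat \<bar>z j\<bar>))"
    using finP by (intro sum_mono2 mult_nonneg_nonneg prod_nonneg) auto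
  also have "\<dots> = 2 ^ n * (\<Sum>z\<in>?P. \<Prod>j\<in>J. (1 / 2 :: real) ^ nat \<bar>z j\<bar>)"
    by (simp add: sum_distrib_left)
  also have "(\<Sum>z\<in>?P. \<Prod>j\<in>J. (1 / 2 :: real) ^ nat \<bar>z j\<bar>)
      = (\<Prod>j\<in>J. \<Sum>k\<in>{- int n..int n}. (1 / 2 :: real) ^ nat \<bar>k\<bar>)"
    by (rule prod_sum_PiE[symmetric]) (use J in auto)
  also have "\<dots> \<le> (\<Prod>j\<in>J. 3)"
    by (intro prod_mono conjI sum_nonneg sum_power_half_abs_le) auto
  also have "\<dots> = 3 ^ card J" by simp
  finally show "real (card ?Z) \<le> 2 ^ n * 3 ^ card J" by simp
qed

text \<open>
  The centres are the points of the lattice with mesh \<open>r / sqrt (card J)\<close> near the ball. Their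
  number is exponential in the dimension, with a rate depending on the bound \<open>A\<close> for \<open>R / r\<close> only: by the
  Cauchy-Schwarz inequality the l1-norm of a point of the ball, in units of the mesh, is at most
  \<open>A * card J\<close>.
\<close>

lemma covered_by_ball:
  fixes R r A :: real
  assumes J: "finite J" and r: "r > 0" and R: "R \<le> A * r" "A \<ge> 0"
  shows "covered_by J {x. L2_set x J \<le> R} r (2 powr (A * card J) * 3 ^ card J)"
proof (cases "J = {}")
  case True
  then show ?thesis using r unfolding covered_by_def
    by (intro exI[of _ "{\<lambda>_. 0}"]) (auto simp: L2_set_def)
next
  case False
  define D where "D = real (card J)"
  have D: "D > 0" using False J by (simp add: D_def card_gt_0_iff)
  define h where "h = r / sqrt D"
  have h: "h > 0" using r D by (simp add: h_def)
  define n where "n = nat \<lfloor>A * D\<rfloor>"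
  have n: "real n \<le> A * D" using R D by (simp add: n_def)
  let ?Z = "{z \<in> J \<rightarrow>\<^sub>E {- int n..int n}. (\<Sum>j\<in>J. nat \<bar>z j\<bar>) \<le> n}"
  note Z = card_small_integer_points[OF J, of n]
  let ?C = "(\<lambda>z j. h * real_of_int (z j)) ` ?Z"
  have "real (card ?C) \<le> real (card ?Z)" using card_image_le[OF Z(1)] by simp
  also have "\<dots> \<le> 2 ^ n * 3 ^ card J" by (rule Z(2))
  also have "2 ^ n = (2::real) powr (real n)" by (simp add: powr_realpow)
  also have "2 powr real n * 3 ^ card J \<le> 2 powr (A * D) * 3 ^ card J"
    using n by (intro mult_right_mono powr_mono) auto
  finally have card: "real (card ?C) \<le> 2 powr (A * D) * 3 ^ card J" .
  have "\<exists>c\<in>?C. L2_set (\<lambda>j. x j - c j) J \<le> r" if x: "L2_set x J \<le> R" for x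
  proof -
    \<comment> \<open>rounding towards 0 does not increase the l1-norm\<close>
    define z where "z = (\<lambda>j\<in>J. if x j \<ge> 0 then \<lfloor>x j / h\<rfloor> else - \<lfloor>- x j / h\<rfloor>)"
    have zabs: "real_of_int \<bar>z j\<bar> \<le> \<bar>x j\<bar> / h" if "j \<in> J" for j
    proof -
      have fl: "real_of_int \<bar>\<lfloor>y / h\<rfloor>\<bar> \<le> y / h" if "y \<ge> 0" for y
        using that h by (simp add: divide_nonneg_pos)
      show ?thesis using that fl[of "x j"] fl[of "- x j"] by (auto simp: z_def)
    qed
    have zdiff: "\<bar>x j - h * real_of_int (z j)\<bar> \<le> h" if "j \<in> J" for j
    proof -
      have fl: "0 \<le> y - h * real_of_int \<lfloor>y / h\<rfloor> \<and> y - h * real_of_int \<lfloor>y / h\<rfloor> \<le> h" for y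
      proof -
        have "real_of_int \<lfloor>y / h\<rfloor> \<le> y / h" "y / h \<le> real_of_int \<lfloor>y / h\<rfloor> + 1" by linarith+
        then have "h * real_of_int \<lfloor>y / h\<rfloor> \<le> h * (y / h)" "h * (y / h) \<le> h * (real_of_int \<lfloor>y / h\<rfloor> + 1)"
          using h by (auto simp only: mult_le_cancel_left_pos)
        then show ?thesis using h by (simp add: field_simps)
      qed
      show ?thesis using that fl[of "x j"] fl[of "- x j"] by (auto simp: z_def)
    qed
    have "real (\<Sum>j\<in>J. nat \<bar>z j\<bar>) = (\<Sum>j\<in>J. real_of_int \<bar>z j\<bar>)" by simp
    also have "\<dots> \<le> (\<Sum>j\<in>J. \<bar>x j\<bar> / h)" by (intro sum_mono zabs)
    also have "\<dots> = (\<Sum>j\<in>J. \<bar>x j\<bar> * \<bar>1\<bar>) / h" by (simp add: sum_divide_distrib)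
    also have "\<dots> \<le> L2_set x J * L2_set (\<lambda>_. 1) J / h"
      using h by (intro divide_right_mono L2_set_mult_ineq) auto
    also have "\<dots> = L2_set x J * sqrt D / h" by (simp add: L2_set_def D_def)
    also have "\<dots> \<le> (A * r) * sqrt D / h"
      using x R h D by (intro divide_right_mono mult_right_mono) auto
    also have "\<dots> = A * D" using r D by (simp add: h_def)
    finally have zs: "(\<Sum>j\<in>J. nat \<bar>z j\<bar>) \<le> n" unfolding n_def by linarith
    have "nat \<bar>z j\<bar> \<le> n" if "j \<in> J" for j
      using member_le_sum[of j J "\<lambda>j. nat \<bar>z j\<bar>"] that J zs by auto
    then have "z j \<in> {- int n..int n}" if "j \<in> J" for j using that by fastforce
    then have "z \<in> J \<rightarrow>\<^sub>E {- int n..int n}" by (auto simp: z_def)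
    then have "z \<in> ?Z" using zs by auto
    moreover have "L2_set (\<lambda>j. x j - h * real_of_int (z j)) J \<le> r"
    proof -
      have "(\<Sum>j\<in>J. (x j - h * real_of_int (z j))\<^sup>2) \<le> (\<Sum>j\<in>J. h\<^sup>2)"
        using zdiff h by (intro sum_mono) (metis abs_le_square_iff abs_of_pos)
      also have "\<dots> = r\<^sup>2" using D by (simp add: h_def D_def power_divide)
      finally show ?thesis using r by (simp add: L2_set_def real_sqrt_le_iff real_le_lsqrt sum_nonneg)
    qed
    ultimately show ?thesis by (intro bexI[of _ "\<lambda>j. h * real_of_int (z j)"] image_eqI[of _ _ z]) auto
  qed
  then show ?thesis using card Z(1) unfolding covered_by_def D_def
    by (intro exI[of _ ?C]) auto
qed

section \<open>Covers of absolute convex hulls\<close>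

definition abs_hull :: "'b set \<Rightarrow> ('b \<Rightarrow> 'a \<Rightarrow> real) \<Rightarrow> ('a \<Rightarrow> real) set" where
  "abs_hull S v = {\<lambda>i. \<Sum>s\<in>S. b s * v s i | b. (\<Sum>s\<in>S. \<bar>b s\<bar>) \<le> 1}"

lemma L2_set_abs_hull_le:
  assumes "x \<in> abs_hull S v" "finite S" "\<And>s. s \<in> S \<Longrightarrow> L2_set (v s) I \<le> \<delta>" "\<delta> \<ge> 0"
  shows "L2_set x I \<le> \<delta>"
proof -
  obtain b where x: "x = (\<lambda>i. \<Sum>s\<in>S. b s * v s i)" and b: "(\<Sum>s\<in>S. \<bar>b s\<bar>) \<le> 1"
    using assms(1) by (auto simp: abs_hull_def)
  have "L2_set (\<lambda>i. \<Sum>s\<in>T. b s * v s i) I \<le> (\<Sum>s\<in>T. \<bar>b s\<bar> * \<delta>)" if "T \<subseteq> S" for T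
    using finite_subset[OF that assms(2)] that
  proof (induction T)
    case (insert t T)
    have "L2_set (\<lambda>i. \<Sum>s\<in>insert t T. b s * v s i) I
        \<le> L2_set (\<lambda>i. b t * v t i) I + L2_set (\<lambda>i. \<Sum>s\<in>T. b s * v s i) I"
      using insert.hyps L2_set_triangle_ineq[where f="\<lambda>i. b t * v t i" and g="\<lambda>i. \<Sum>s\<in>T. b s * v s i" and A=I] by simp
    also have "L2_set (\<lambda>i. b t * v t i) I = \<bar>b t\<bar> * L2_set (v t) I"
      by (simp add: L2_set_def power_mult_distrib sum_distrib_left[symmetric] real_sqrt_mult)
    also have "\<bar>b t\<bar> * L2_set (v t) I + L2_set (\<lambda>i. \<Sum>s\<in>T. b s * v s i) I \<le> \<bar>b t\<bar> * \<delta> + (\<Sum>s\<in>T. \<bar>b s\<bar> * \<delta>)"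
      using insert assms(3) by (intro add_mono mult_left_mono) auto
    finally show ?case using insert.hyps by simp
  qed (simp add: L2_set_def)
  from this[of S] have "L2_set x I \<le> (\<Sum>s\<in>S. \<bar>b s\<bar>) * \<delta>" by (simp add: x sum_distrib_right)
  also have "\<dots> \<le> 1 * \<delta>" using b assms(4) by (intro mult_right_mono)
  finally show ?thesis by simp
qed

text \<open>
  A linear functional on the hull attains its minimum at a generator or its negative.
\<close>

lemma abs_hull_separation:
  assumes x: "x \<in> abs_hull S v" and S: "finite S" "S \<noteq> {}"
  shows "\<exists>s\<in>S. \<exists>\<sigma>\<in>{-1, 1}. (\<Sum>i\<in>I. g i * (\<sigma> * v s i)) \<le> (\<Sum>i\<in>I. g i * x i)"
proof -
  obtain b where xb: "x = (\<lambda>i. \<Sum>s\<in>S. b s * v s i)" and b: "(\<Sum>s\<in>S. \<bar>b s\<bar>) \<le> 1"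
    using x by (auto simp: abs_hull_def)
  define w where "w s = (\<Sum>i\<in>I. g i * v s i)" for s
  define M where "M = Max ((\<lambda>s. \<bar>w s\<bar>) ` S)"
  have "M \<in> (\<lambda>s. \<bar>w s\<bar>) ` S" unfolding M_def using S by (intro Max_in) auto
  then obtain s where s: "s \<in> S" "\<bar>w s\<bar> = M" by auto
  have le: "\<bar>w t\<bar> \<le> M" if "t \<in> S" for t unfolding M_def using S that by (intro Max_ge) auto
  have M0: "M \<ge> 0" using s by auto
  have "(\<Sum>i\<in>I. g i * x i) = (\<Sum>t\<in>S. b t * w t)"
    unfolding xb w_def by (simp add: sum_distrib_left mult_ac sum.swap[of _ I S])
  moreover have "\<bar>\<Sum>t\<in>S. b t * w t\<bar> \<le> (\<Sum>t\<in>S. \<bar>b t\<bar> * M)"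
    using le by (intro order_trans[OF sum_abs] sum_mono) (auto simp: abs_mult intro: mult_left_mono)
  moreover have "(\<Sum>t\<in>S. \<bar>b t\<bar> * M) \<le> 1 * M"
    unfolding sum_distrib_right[symmetric] using b M0 by (intro mult_right_mono)
  ultimately have ge: "(\<Sum>i\<in>I. g i * x i) \<ge> - M" by linarith
  define \<sigma> :: real where "\<sigma> = (if w s \<ge> 0 then -1 else 1)"
  have "(\<Sum>i\<in>I. g i * (\<sigma> * v s i)) = \<sigma> * w s" by (simp add: w_def sum_distrib_left mult_ac)
  also have "\<dots> = - M" using s by (auto simp: \<sigma>_def)
  finally show ?thesis using ge s by (intro bexI[of _ s] bexI[of _ \<sigma>]) (auto simp: \<sigma>_def)
qed

text \<open>
  A deterministic form of the argument of Maurey. If the error \<open>g\<close> accumulated so far satisfies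
  \<open>\<langle>g, u\<rangle> \<le> 0\<close> for the next difference \<open>u\<close> between a signed generator and \<open>x\<close>, the squared
  errors add up. Such a generator exists by \<open>abs_hull_separation\<close>.
\<close>

lemma greedy_approximation:
  assumes x: "x \<in> abs_hull S v" and S: "finite S" "S \<noteq> {}"
    and v: "\<And>s. s \<in> S \<Longrightarrow> L2_set (v s) I \<le> \<delta>" and \<delta>: "\<delta> \<ge> 0"
  shows "\<exists>f\<in>{..<n} \<rightarrow>\<^sub>E (S \<times> {-1, 1::real}).
      L2_set (\<lambda>i. (\<Sum>k<n. snd (f k) * v (fst (f k)) i) - real n * x i) I ^ 2 \<le> real n * (2 * \<delta>)\<^sup>2"
proof (induction n)
  case 0 show ?case by (auto simp: L2_set_def)
next
  case (Suc n)
  then obtain f where f: "f \<in> {..<n} \<rightarrow>\<^sub>E (S \<times> {-1, 1::real})"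
    and le: "L2_set (\<lambda>i. (\<Sum>k<n. snd (f k) * v (fst (f k)) i) - real n * x i) I ^ 2 \<le> real n * (2 * \<delta>)\<^sup>2"
    by blast
  define g where "g i = (\<Sum>k<n. snd (f k) * v (fst (f k)) i) - real n * x i" for i
  obtain s \<sigma> where s: "s \<in> S" "\<sigma> \<in> {-1, 1::real}"
    and neg: "(\<Sum>i\<in>I. g i * (\<sigma> * v s i)) \<le> (\<Sum>i\<in>I. g i * x i)"
    using abs_hull_separation[OF x S, where I=I and g=g] by blast
  let ?f = "f(n := (s, \<sigma>))"
  have "?f \<in> {..<Suc n} \<rightarrow>\<^sub>E (S \<times> {-1, 1::real})" using f s by (auto simp: less_Suc_eq PiE_def extensional_def Pi_def)
  moreover have "L2_set (\<lambda>i. (\<Sum>k<Suc n. snd (?f k) * v (fst (?f k)) i) - real (Suc n) * x i) I ^ 2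
      \<le> real (Suc n) * (2 * \<delta>)\<^sup>2"
  proof -
    let ?u = "\<lambda>i. \<sigma> * v s i - x i"
    have "(\<Sum>k<Suc n. snd (?f k) * v (fst (?f k)) i) - real (Suc n) * x i = g i + ?u i" for i
      by (simp add: g_def algebra_simps)
    then have "L2_set (\<lambda>i. (\<Sum>k<Suc n. snd (?f k) * v (fst (?f k)) i) - real (Suc n) * x i) I ^ 2
        = (\<Sum>i\<in>I. (g i + ?u i)\<^sup>2)"
      by (simp only: L2_set_def) (simp add: sum_nonneg)
    also have "\<dots> = (\<Sum>i\<in>I. (g i)\<^sup>2) + 2 * (\<Sum>i\<in>I. g i * ?u i) + (\<Sum>i\<in>I. (?u i)\<^sup>2)"
      by (simp only: power2_sum sum.distrib sum_distrib_left mult.assoc)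
    also have "(\<Sum>i\<in>I. (g i)\<^sup>2) = (L2_set g I)\<^sup>2" by (simp add: L2_set_def sum_nonneg)
    also have "(\<Sum>i\<in>I. (?u i)\<^sup>2) = (L2_set ?u I)\<^sup>2" by (simp add: L2_set_def sum_nonneg)
    also have "(L2_set g I)\<^sup>2 \<le> real n * (2 * \<delta>)\<^sup>2" using le by (simp add: g_def[abs_def])
    also have "(\<Sum>i\<in>I. g i * ?u i) \<le> 0"
      using neg by (simp add: right_diff_distrib sum_subtractf)
    also have "(L2_set ?u I)\<^sup>2 \<le> (2 * \<delta>)\<^sup>2"
    proof (rule power_mono)
      have "L2_set ?u I \<le> L2_set (\<lambda>i. \<sigma> * v s i) I + L2_set (\<lambda>i. - x i) I"
        using L2_set_triangle_ineq[where f="\<lambda>i. \<sigma> * v s i" and g="\<lambda>i. - x i" and A=I] by simp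
      also have "L2_set (\<lambda>i. \<sigma> * v s i) I = L2_set (v s) I" using s(2)
        by (auto simp: L2_set_def)
      also have "L2_set (\<lambda>i. - x i) I = L2_set x I" by (simp add: L2_set_def)
      finally show "L2_set ?u I \<le> 2 * \<delta>" using v[OF s(1)] L2_set_abs_hull_le[OF x S(1) v \<delta>] by simp
    qed simp
    finally show ?thesis by (simp add: algebra_simps)
  qed
  ultimately show ?case by blast
qed

text \<open>
  By \<open>greedy_approximation\<close>, averages of \<open>n\<close> signed generators with
  \<open>n \<ge> 4 * (\<delta> / r)\<^sup>2\<close> suffice as centres, and there are \<open>(2 * card S) ^ n\<close> of them.
\<close>

lemma covered_by_abs_hull:
  assumes S: "finite S" "S \<noteq> {}" and v: "\<And>s. s \<in> S \<Longrightarrow> L2_set (v s) I \<le> \<delta>" and \<delta>: "\<delta> \<ge> 0"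
    and r: "r > 0" and \<Lambda>: "ln (2 * card S) \<le> \<Lambda>"
  shows "covered_by I (abs_hull S v) r (exp (8 * (\<delta> / r)\<^sup>2 * \<Lambda>))"
proof -
  have cS: "card S \<ge> 1" using S by (simp add: Suc_leI card_gt_0_iff)
  have "0 \<le> ln (real (2 * card S))" using cS by (intro ln_ge_zero) auto
  then have \<Lambda>0: "\<Lambda> \<ge> 0" using \<Lambda> by simp
  show ?thesis
  proof (cases "\<delta> \<le> r")
    case True
    have "L2_set (\<lambda>i. x i - 0) I \<le> r" if "x \<in> abs_hull S v" for x
      using L2_set_abs_hull_le[OF that S(1) v \<delta>] True by simp
    moreover have "1 \<le> exp (8 * (\<delta> / r)\<^sup>2 * \<Lambda>)" using \<Lambda>0 by simp
    ultimately show ?thesis unfolding covered_by_def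
      by (intro exI[of _ "{\<lambda>_. 0}"]) auto
  next
    case False
    \<comment> \<open>as \<open>?y \<ge> 1\<close>, rounding up at most doubles it\<close>
    let ?y = "4 * (\<delta> / r)\<^sup>2"
    define n where "n = nat \<lceil>?y\<rceil>"
    have "\<delta> / r > 1" using False r by simp
    then have "1 < (\<delta> / r)\<^sup>2" by (intro one_less_power) auto
    then have y1: "?y \<ge> 1" by linarith
    have n: "real n \<ge> ?y" "real n \<le> 2 * ?y" "n > 0" using y1 unfolding n_def by linarith+
    let ?P = "{..<n} \<rightarrow>\<^sub>E (S \<times> {-1, 1::real})"
    have finP: "finite ?P" using S by (intro finite_PiE) auto
    let ?c = "\<lambda>f i. (\<Sum>k<n. snd (f k) * v (fst (f k)) i) / real n"
    have "real (card (?c ` ?P)) \<le> real (card ?P)" using card_image_le[OF finP] by simp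
    also have "card ?P = (2 * card S) ^ n"
      using S by (subst card_PiE) (auto simp: card_cartesian_product mult.commute[of "card S"] simp flip: mult_2)
    also have "real ((2 * card S) ^ n) = exp (real n * ln (2 * card S))"
      using cS by (simp add: exp_of_nat_mult)
    also have "\<dots> \<le> exp (2 * ?y * \<Lambda>)"
      using n \<Lambda> cS \<Lambda>0 by (auto intro!: mult_mono)
    finally have card: "real (card (?c ` ?P)) \<le> exp (8 * (\<delta> / r)\<^sup>2 * \<Lambda>)" by simp
    have "\<exists>c\<in>?c ` ?P. L2_set (\<lambda>i. x i - c i) I \<le> r" if x: "x \<in> abs_hull S v" for x
    proof -
      obtain f where f: "f \<in> ?P" and
        le: "L2_set (\<lambda>i. (\<Sum>k<n. snd (f k) * v (fst (f k)) i) - real n * x i) I ^ 2 \<le> real n * (2 * \<delta>)\<^sup>2"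
        using greedy_approximation[OF x S v \<delta>, of n] by blast
      let ?d = "\<lambda>i. (\<Sum>k<n. snd (f k) * v (fst (f k)) i) - real n * x i"
      have "x i - ?c f i = (- 1 / real n) * ?d i" for i using n(3) by (simp add: field_simps)
      then have "L2_set (\<lambda>i. x i - ?c f i) I ^ 2 = (1 / real n)\<^sup>2 * L2_set ?d I ^ 2"
        by (simp only: L2_set_def) (simp add: sum_nonneg power_mult_distrib sum_distrib_left power_divide)
      also have "\<dots> \<le> (1 / real n)\<^sup>2 * (real n * (2 * \<delta>)\<^sup>2)" using le by (intro mult_left_mono) auto
      also have "\<dots> = 4 * \<delta>\<^sup>2 / real n" using n(3) by (simp add: power2_eq_square)
      also have "\<dots> \<le> r\<^sup>2" using n(1,3) r by (simp add: field_simps power_divide)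
      finally have "L2_set (\<lambda>i. x i - ?c f i) I \<le> r" by (rule power2_le_imp_le) (use r in simp)
      then show ?thesis using f by (intro bexI[where x = "?c f"] imageI)
    qed
    then show ?thesis using card finite_imageI[OF finP, of ?c] unfolding covered_by_def by blast
  qed
qed


lemma L2_set_split_le:
  assumes "finite I" "J \<subseteq> I"
  shows "L2_set f I \<le> L2_set f J + L2_set f (I - J)"
proof -
  have "(\<Sum>i\<in>I. (f i)\<^sup>2) = (\<Sum>i\<in>J. (f i)\<^sup>2) + (\<Sum>i\<in>I - J. (f i)\<^sup>2)"
    using assms by (simp add: sum.subset_diff add.commute)
  then show ?thesis unfolding L2_set_def using sqrt_add_le_add_sqrt by (simp add: sum_nonneg)
qed

text \<open>
  The coordinates in \<open>J\<close> are approximated by refining a given coarse cover, the others from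
  scratch.
\<close>

lemma covered_by_split:
  assumes I: "finite I" "J \<subseteq> I"
    and F: "covered_by I F R N1"
    and ball: "covered_by J {x. L2_set x J \<le> R} r1 N2"
    and rest: "covered_by (I - J) F r2 N3"
  shows "covered_by I F (r1 + r2) (N1 * N2 * N3)"
proof -
  obtain C1 where C1: "finite C1" "real (card C1) \<le> N1" "\<And>x. x \<in> F \<Longrightarrow> \<exists>c\<in>C1. L2_set (\<lambda>i. x i - c i) I \<le> R"
    using F by (auto simp: covered_by_def)
  obtain C2 where C2: "finite C2" "real (card C2) \<le> N2" "\<And>x. L2_set x J \<le> R \<Longrightarrow> \<exists>c\<in>C2. L2_set (\<lambda>i. x i - c i) J \<le> r1"
    using ball by (auto simp: covered_by_def)
  obtain C3 where C3: "finite C3" "real (card C3) \<le> N3" "\<And>x. x \<in> F \<Longrightarrow> \<exists>c\<in>C3. L2_set (\<lambda>i. x i - c i) (I - J) \<le> r2"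
    using rest by (auto simp: covered_by_def)
  let ?g = "\<lambda>(c1, c2, c3) i. if i \<in> J then c1 i + c2 i else c3 i"
  let ?C = "?g ` (C1 \<times> C2 \<times> C3)"
  have "real (card ?C) \<le> real (card (C1 \<times> C2 \<times> C3))"
    using C1(1) C2(1) C3(1) by (intro of_nat_mono card_image_le) auto
  also have "\<dots> = real (card C1) * real (card C2) * real (card C3)"
    by (simp add: card_cartesian_product)
  also have "\<dots> \<le> N1 * N2 * N3"
    by (intro mult_mono C1 C2 C3 mult_nonneg_nonneg) (use C1(2) C2(2) in \<open>auto intro: order_trans[rotated]\<close>)
  finally have card: "real (card ?C) \<le> N1 * N2 * N3" .
  have "\<exists>c\<in>?C. L2_set (\<lambda>i. x i - c i) I \<le> r1 + r2" if x: "x \<in> F" for x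
  proof -
    obtain c1 where c1: "c1 \<in> C1" "L2_set (\<lambda>i. x i - c1 i) I \<le> R" using C1(3)[OF x] by blast
    have "L2_set (\<lambda>i. x i - c1 i) J \<le> L2_set (\<lambda>i. x i - c1 i) I"
      unfolding L2_set_def using I by (intro real_sqrt_le_mono sum_mono2) auto
    then obtain c2 where c2: "c2 \<in> C2" "L2_set (\<lambda>i. x i - c1 i - c2 i) J \<le> r1"
      using C2(3)[of "\<lambda>i. x i - c1 i"] c1 by auto
    obtain c3 where c3: "c3 \<in> C3" "L2_set (\<lambda>i. x i - c3 i) (I - J) \<le> r2" using C3(3)[OF x] by blast
    let ?c = "?g (c1, c2, c3)"
    have "L2_set (\<lambda>i. x i - ?c i) I \<le> L2_set (\<lambda>i. x i - ?c i) J + L2_set (\<lambda>i. x i - ?c i) (I - J)"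
      by (rule L2_set_split_le[OF I])
    also have "L2_set (\<lambda>i. x i - ?c i) J = L2_set (\<lambda>i. x i - c1 i - c2 i) J"
      by (rule L2_set_cong) auto
    also have "L2_set (\<lambda>i. x i - ?c i) (I - J) = L2_set (\<lambda>i. x i - c3 i) (I - J)"
      by (rule L2_set_cong) auto
    finally have "L2_set (\<lambda>i. x i - ?c i) I \<le> r1 + r2" using c2 c3 by simp
    then show ?thesis using c1 c2 c3 by (intro bexI[of _ ?c] image_eqI[of _ _ "(c1, c2, c3)"]) auto
  qed
  then show ?thesis using card C1(1) C2(1) C3(1) unfolding covered_by_def
    by (intro exI[of _ ?C]) auto
qed

lemma covered_by_mono: "covered_by I F \<rho> N \<Longrightarrow> \<rho> \<le> \<rho>' \<Longrightarrow> N \<le> N' \<Longrightarrow> covered_by I F \<rho>' N'"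
  unfolding covered_by_def by (meson order_trans)

text \<open>
  Each refinement multiplies the size of the cover by the exponential of a constant times the
  dimension \<open>D k\<close>. The coarse cover confines the remainder to a ball whose radius is at most
  \<open>A\<close> times half of the new one, and this keeps a logarithm of the accuracy out of the exponent.
\<close>

lemma covered_by_abs_hull_chain:
  assumes I: "finite I" and S: "finite S" "S \<noteq> {}" 
    and v: "\<And>s. s \<in> S \<Longrightarrow> L2_set (v s) I \<le> \<rho> 0"
    and J: "\<And>k. J k \<subseteq> I" "\<And>k. real (card (J k)) \<le> D k"
    and tail: "\<And>k s. s \<in> S \<Longrightarrow> L2_set (v s) (I - J k) \<le> \<delta> k" "\<And>k. \<delta> k \<ge> 0"
    and \<rho>: "\<And>k. \<rho> k > 0" "\<And>k. 2 * \<rho> k \<le> A * \<rho> (Suc k)"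
    and \<Lambda>: "ln (2 * card S) \<le> \<Lambda>" "\<And>k. 32 * (\<delta> k / \<rho> k)\<^sup>2 * \<Lambda> \<le> B * D k"
  shows "covered_by I (abs_hull S v) (\<rho> K) (exp ((A * ln 2 + ln 3 + B) * (\<Sum>k\<le>K. D k)))"
proof (induction K)
  have A: "A > 0"
  proof -
    have "0 < A * \<rho> 1" using \<rho>(1)[of 0] \<rho>(2)[of 0] by simp
    then show ?thesis using \<rho>(1)[of 1] by (simp add: zero_less_mult_iff)
  qed
  have D: "D k \<ge> 0" for k using J(2)[of k] by linarith
  have BD: "B * D k \<ge> 0" for k
  proof -
    have "card S \<ge> 1" using S by (simp add: Suc_leI card_gt_0_iff)
    then have "0 \<le> ln (real (2 * card S))" by (intro ln_ge_zero) auto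
    then have "0 \<le> \<Lambda>" using \<Lambda>(1) by simp
    then have "0 \<le> 32 * (\<delta> k / \<rho> k)\<^sup>2 * \<Lambda>" by simp
    then show ?thesis using \<Lambda>(2)[of k] by linarith
  qed
  {
    case 0
    have "L2_set (\<lambda>i. x i - 0) I \<le> \<rho> 0" if "x \<in> abs_hull S v" for x
      using L2_set_abs_hull_le[OF that S(1) v] \<rho>(1)[of 0] by simp
    moreover have "0 \<le> (A * ln 2 + ln 3 + B) * D 0"
      using A D[of 0] BD[of 0] by (simp add: distrib_right)
    ultimately show ?case unfolding covered_by_def
      by (intro exI[of _ "{\<lambda>_. 0}"]) auto
  next
    case (Suc K)
    let ?J = "J (Suc K)" and ?r = "\<rho> (Suc K) / 2"
    have r: "?r > 0" using \<rho>(1) by simp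
    have fJ: "finite ?J" by (rule finite_subset[OF J(1) I])
    have "covered_by I (abs_hull S v) (?r + ?r) (exp ((A * ln 2 + ln 3 + B) * (\<Sum>k\<le>K. D k))
       * (2 powr (A * card ?J) * 3 ^ card ?J) * exp (8 * (\<delta> (Suc K) / ?r)\<^sup>2 * \<Lambda>))"
    proof (rule covered_by_split[OF I J(1) Suc.IH])
      show "covered_by ?J {x. L2_set x ?J \<le> \<rho> K} ?r (2 powr (A * card ?J) * 3 ^ card ?J)"
        using covered_by_ball[OF fJ r, of "\<rho> K" A] \<rho>(2)[of K] A by simp
      show "covered_by (I - ?J) (abs_hull S v) ?r (exp (8 * (\<delta> (Suc K) / ?r)\<^sup>2 * \<Lambda>))"
        by (rule covered_by_abs_hull[OF S tail r \<Lambda>(1)])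
    qed
    then show ?case
    proof (rule covered_by_mono)
      have "2 powr (A * card ?J) * 3 ^ card ?J = exp ((A * ln 2 + ln 3) * card ?J)"
      proof -
        have "(3::real) ^ card ?J = exp (real (card ?J) * ln 3)" by (simp add: exp_of_nat_mult)
        then show ?thesis by (simp add: powr_def exp_add[symmetric] algebra_simps)
      qed
      also have "\<dots> \<le> exp ((A * ln 2 + ln 3) * D (Suc K))"
        using A J(2) by (auto intro!: mult_left_mono add_nonneg_nonneg)
      finally have 1: "2 powr (A * card ?J) * 3 ^ card ?J \<le> exp ((A * ln 2 + ln 3) * D (Suc K))" .
      have 2: "exp (8 * (\<delta> (Suc K) / ?r)\<^sup>2 * \<Lambda>) \<le> exp (B * D (Suc K))"
        using \<Lambda>(2)[of "Suc K"] by (simp add: power_divide power_mult_distrib)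
      have "exp ((A * ln 2 + ln 3 + B) * (\<Sum>k\<le>K. D k))
         * (2 powr (A * card ?J) * 3 ^ card ?J) * exp (8 * (\<delta> (Suc K) / ?r)\<^sup>2 * \<Lambda>)
        \<le> exp ((A * ln 2 + ln 3 + B) * (\<Sum>k\<le>K. D k)) * exp ((A * ln 2 + ln 3) * D (Suc K)) * exp (B * D (Suc K))"
        using 1 2 by (intro mult_mono) auto
      also have "\<dots> = exp ((A * ln 2 + ln 3 + B) * (\<Sum>k\<le>Suc K. D k))"
        by (simp add: exp_add[symmetric] algebra_simps)
      finally show "exp ((A * ln 2 + ln 3 + B) * (\<Sum>k\<le>K. D k))
         * (2 powr (A * card ?J) * 3 ^ card ?J) * exp (8 * (\<delta> (Suc K) / ?r)\<^sup>2 * \<Lambda>)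
        \<le> exp ((A * ln 2 + ln 3 + B) * (\<Sum>k\<le>Suc K. D k))" .
    qed simp
  }
qed

section \<open>Approximation and covering numbers of matrices\<close>

lemma l2norm_nonneg: "l2norm v \<ge> 0"
  by (simp add: l2norm_def scalar_prod_self sum_nonneg)

text \<open>
  The set \<open>J\<close> must not be empty because the dimensions in \<open>approx_dim\<close> start at 1.
\<close>

lemma approx_dim_le:
  assumes X: "dim_col X \<ge> 1" and n: "n = dim_row X"
    and Q: "Q \<in> carrier_mat n n" "transpose_mat Q * Q = 1\<^sub>m n" and J: "J \<subseteq> {..<n}" "J \<noteq> {}" and e: "\<epsilon> \<ge> 0"
    and tail: "\<And>j. j < dim_col X \<Longrightarrow> (\<Sum>i\<in>{..<n} - J. (Matrix.col Q i \<bullet> Matrix.col X j)\<^sup>2) \<le> \<epsilon>\<^sup>2"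
  shows "approx_dim \<epsilon> X \<le> card J"
proof -
  obtain W where W: "linear_space_of_dim n (card J) W"
    and P: "\<And>x. x \<in> carrier_vec n \<Longrightarrow> (l2norm (proj_orthocomp n W x))\<^sup>2 = (\<Sum>i\<in>{..<n} - J. (Matrix.col Q i \<bullet> x)\<^sup>2)"
    using coordinate_space_proj[OF Q J(1)] by blast
  have ne: "{..<dim_col X} \<noteq> {}" using X by (simp add: lessThan_empty_iff)
  have "approx_err W X \<le> \<epsilon>"
    unfolding approx_err_def n[symmetric]
  proof (rule Max.boundedI)
    fix a assume "a \<in> (\<lambda>j. l2norm (proj_orthocomp n W (Matrix.col X j))) ` {..<dim_col X}"
    then obtain j where j: "j < dim_col X" "a = l2norm (proj_orthocomp n W (Matrix.col X j))" by auto
    have "a\<^sup>2 \<le> \<epsilon>\<^sup>2" unfolding j(2) using P[of "Matrix.col X j"] tail[OF j(1)] n by auto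
    then show "a \<le> \<epsilon>" by (rule power2_le_imp_le) (rule e)
  qed (use ne in auto)
  moreover have "approx_err_dim (card J) X \<le> approx_err W X"
    unfolding approx_err_dim_def
  proof (rule cInf_lower)
    show "approx_err W X \<in> {approx_err V X |V. linear_space_of_dim (dim_row X) (card J) V}"
      using W n by blast
    have "0 \<le> approx_err V X" for V
    proof -
      have "0 \<le> l2norm (proj_orthocomp (dim_row X) V (Matrix.col X 0))" by (rule l2norm_nonneg)
      also have "\<dots> \<le> approx_err V X" unfolding approx_err_def using X by (intro Max_ge) auto
      finally show ?thesis .
    qed
    then show "bdd_below {approx_err V X |V. linear_space_of_dim (dim_row X) (card J) V}"
      by (intro bdd_belowI[of _ 0]) auto
  qed
  ultimately have "approx_err_dim (card J) X \<le> \<epsilon>" by simp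
  moreover have "card J \<in> {1..dim_row X}"
    using J n card_mono[OF _ J(1)] finite_subset[OF J(1)] by (auto simp: Suc_le_eq card_gt_0_iff)
  ultimately show ?thesis unfolding approx_dim_def by (intro Least_le) auto
qed

lemma l2dist_eq_L2_set:
  assumes "u \<in> carrier_vec n" "v \<in> carrier_vec n"
  shows "l2dist u v = L2_set (\<lambda>i. u $ i - v $ i) {..<n}"
  using assms by (auto simp: l2dist_def l2norm_eq_L2_set intro!: L2_set_cong)

lemma covering_number_le:
  assumes "C \<subseteq> carrier_vec n" "finite C" "\<And>x. x \<in> T \<Longrightarrow> \<exists>c\<in>C. l2dist x c \<le> \<epsilon>"
  shows "covering_number n \<epsilon> T \<le> card C"
  unfolding covering_number_def
  by (rule Least_le) (use assms in \<open>intro exI[of _ C], auto\<close>)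

text \<open>
  The centres are columns again, given by their indices. This keeps their norms at most 1 under
  tensor products, and it lets them inherit the approximation properties of the columns.
\<close>

definition col_net :: "real Matrix.mat \<Rightarrow> real \<Rightarrow> nat set \<Rightarrow> bool" where
  "col_net A \<epsilon> S \<longleftrightarrow> S \<subseteq> {..<dim_col A} \<and>
     (\<forall>j<dim_col A. \<exists>s\<in>S. L2_set (\<lambda>i. A $$ (i, j) - A $$ (i, s)) {..<dim_row A} \<le> \<epsilon>)"

lemma l2dist_col:
  assumes "j < dim_col A" "s < dim_col A"
  shows "l2dist (Matrix.col A j) (Matrix.col A s) = L2_set (\<lambda>i. A $$ (i, j) - A $$ (i, s)) {..<dim_row A}"
  using assms by (subst l2dist_eq_L2_set[where n = "dim_row A"]) (auto intro!: L2_set_cong)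

lemma covering_cols_le:
  assumes "col_net A \<epsilon> S"
  shows "covering_cols \<epsilon> A \<le> card S"
proof -
  have S: "S \<subseteq> {..<dim_col A}" using assms by (simp add: col_net_def)
  then have fin: "finite S" by (rule finite_subset) simp
  have "covering_cols \<epsilon> A \<le> card (Matrix.col A ` S)"
    unfolding covering_cols_def
  proof (rule covering_number_le)
    fix x assume "x \<in> set (cols A)"
    then obtain j where j: "j < dim_col A" "x = Matrix.col A j" by (auto simp: cols_def)
    then obtain s where "s \<in> S" "L2_set (\<lambda>i. A $$ (i, j) - A $$ (i, s)) {..<dim_row A} \<le> \<epsilon>"
      using assms by (auto simp: col_net_def)
    then show "\<exists>c\<in>Matrix.col A ` S. l2dist x c \<le> \<epsilon>"
      using j l2dist_col[of j A s] S by (intro bexI[of _ "Matrix.col A s"]) auto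
  qed (use fin in auto)
  also have "\<dots> \<le> card S" using fin by (rule card_image_le)
  finally show ?thesis .
qed

text \<open>
  Moving a centre to a column in its ball doubles the radius.
\<close>

lemma col_net_exists:
  assumes "\<epsilon> \<ge> 0"
  shows "\<exists>S. col_net A (2 * \<epsilon>) S \<and> card S \<le> covering_cols \<epsilon> A"
proof -
  let ?n = "dim_row A"
  let ?P = "\<lambda>k. \<exists>C\<subseteq>carrier_vec ?n. finite C \<and> card C = k \<and> set (cols A) \<subseteq> (\<Union>c\<in>C. {x. l2dist x c \<le> \<epsilon>})"
  have "?P (card (set (cols A)))"
    using assms by (intro exI[of _ "set (cols A)"]) (auto simp: cols_def l2dist_eq_L2_set[where n = ?n] L2_set_def)
  then have "?P (covering_cols \<epsilon> A)"
    unfolding covering_cols_def covering_number_def by (rule LeastI)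
  then obtain C where C: "C \<subseteq> carrier_vec ?n" "finite C" "card C = covering_cols \<epsilon> A"
    "set (cols A) \<subseteq> (\<Union>c\<in>C. {x. l2dist x c \<le> \<epsilon>})" by blast
  define C' where "C' = {c \<in> C. \<exists>j<dim_col A. l2dist (Matrix.col A j) c \<le> \<epsilon>}"
  define f where "f c = (SOME j. j < dim_col A \<and> l2dist (Matrix.col A j) c \<le> \<epsilon>)" for c
  have f: "f c < dim_col A \<and> l2dist (Matrix.col A (f c)) c \<le> \<epsilon>" if "c \<in> C'" for c
    unfolding f_def by (rule someI_ex) (use that C'_def in auto)
  have "finite C'" "card C' \<le> card C" using C(2) by (auto simp: C'_def intro!: card_mono)
  then have card: "card (f ` C') \<le> covering_cols \<epsilon> A" using card_image_le[of C' f] C(3) by simp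
  have "\<exists>s\<in>f ` C'. L2_set (\<lambda>i. A $$ (i, j) - A $$ (i, s)) {..<?n} \<le> 2 * \<epsilon>" if j: "j < dim_col A" for j
  proof -
    have "Matrix.col A j \<in> set (cols A)" using j by (auto simp: cols_def)
    then obtain c where c: "c \<in> C" "l2dist (Matrix.col A j) c \<le> \<epsilon>" using C(4) by auto
    then have cC: "c \<in> C'" using j by (auto simp: C'_def)
    note fc = f[OF cC]
    have cc: "c \<in> carrier_vec ?n" using c C by auto
    have 1: "L2_set (\<lambda>i. Matrix.col A j $ i - c $ i) {..<?n} \<le> \<epsilon>"
      using c(2) l2dist_eq_L2_set[of "Matrix.col A j" ?n c] cc by auto
    have 2: "L2_set (\<lambda>i. Matrix.col A (f c) $ i - c $ i) {..<?n} \<le> \<epsilon>"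
      using fc l2dist_eq_L2_set[of "Matrix.col A (f c)" ?n c] cc by auto
    have "L2_set (\<lambda>i. A $$ (i, j) - A $$ (i, f c)) {..<?n}
       = L2_set (\<lambda>i. (Matrix.col A j $ i - c $ i) + - (Matrix.col A (f c) $ i - c $ i)) {..<?n}"
      using j fc by (intro L2_set_cong) auto
    also have "\<dots> \<le> L2_set (\<lambda>i. Matrix.col A j $ i - c $ i) {..<?n} + L2_set (\<lambda>i. - (Matrix.col A (f c) $ i - c $ i)) {..<?n}"
      by (rule L2_set_triangle_ineq)
    also have "L2_set (\<lambda>i. - (Matrix.col A (f c) $ i - c $ i)) {..<?n} = L2_set (\<lambda>i. Matrix.col A (f c) $ i - c $ i) {..<?n}"
      by (simp add: L2_set_def power2_commute)
    finally have "L2_set (\<lambda>i. A $$ (i, j) - A $$ (i, f c)) {..<?n} \<le> 2 * \<epsilon>" using 1 2 by simp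
    then show ?thesis using cC by blast
  qed
  moreover have "f ` C' \<subseteq> {..<dim_col A}" using f by auto
  ultimately show ?thesis using card unfolding col_net_def by blast
qed

lemma L2_set_product:
  "L2_set (\<lambda>i. f (i div k) * g (i mod k)) {..<m * k} = L2_set f {..<m} * L2_set g {..<k}" for f g :: "nat \<Rightarrow> real"
proof -
  have "(\<Sum>i<m * k. (f (i div k) * g (i mod k))\<^sup>2) = (\<Sum>a<m. \<Sum>b<k. (f a * g b)\<^sup>2)"
    by (rule sum_div_mod)
  also have "\<dots> = (\<Sum>a<m. (f a)\<^sup>2) * (\<Sum>b<k. (g b)\<^sup>2)" by (simp add: sum_product power_mult_distrib)
  finally show ?thesis by (simp add: L2_set_def real_sqrt_mult)
qed

lemma tensor_power_col_norm:
  assumes "\<And>j. j < dim_col A \<Longrightarrow> L2_set (\<lambda>i. A $$ (i, j)) {..<dim_row A} \<le> 1" and "j < dim_col A ^ d"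
  shows "L2_set (\<lambda>i. tensor_power A d $$ (i, j)) {..<dim_row A ^ d} \<le> 1"
  using assms(2)
proof (induction d arbitrary: j)
  case 0 then show ?case by (simp add: L2_set_def)
next
  case (Suc d)
  let ?k = "dim_row A ^ d" and ?r = "dim_col A ^ d"
  have j: "j < dim_col A * ?r" using Suc.prems by simp
  have "L2_set (\<lambda>i. tensor_power A (Suc d) $$ (i, j)) {..<dim_row A ^ Suc d}
     = L2_set (\<lambda>i. A $$ (i div ?k, j div ?r) * tensor_power A d $$ (i mod ?k, j mod ?r)) {..<dim_row A * ?k}"
    using j by (intro L2_set_cong) (auto simp: index_kron)
  also have "\<dots> = L2_set (\<lambda>i. A $$ (i, j div ?r)) {..<dim_row A} * L2_set (\<lambda>i. tensor_power A d $$ (i, j mod ?r)) {..<?k}"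
    by (rule L2_set_product)
  also have "\<dots> \<le> 1 * 1" using assms(1) Suc.IH div_mod_bounds[OF j] by (intro mult_mono) (auto simp: L2_set_nonneg)
  finally show ?case by simp
qed

text \<open>
  Induction with \<open>a \<otimes> b - a' \<otimes> b' = (a - a') \<otimes> b + a' \<otimes> (b - b')\<close>, where \<open>a'\<close> and
  \<open>b\<close> have norm at most 1.
\<close>

lemma col_net_tensor_power:
  assumes A: "\<And>j. j < dim_col A \<Longrightarrow> L2_set (\<lambda>i. A $$ (i, j)) {..<dim_row A} \<le> 1"
    and S: "col_net A \<epsilon> S"
  shows "\<exists>T. col_net (tensor_power A d) (real d * \<epsilon>) T \<and> card T \<le> card S ^ d"
proof (induction d)
  case 0
  show ?case by (intro exI[of _ "{0}"]) (auto simp: col_net_def L2_set_def)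
next
  case (Suc d)
  then obtain T where T: "col_net (tensor_power A d) (real d * \<epsilon>) T" "card T \<le> card S ^ d" by blast
  let ?X = "tensor_power A d" and ?Y = "tensor_power A (Suc d)"
  let ?k = "dim_row A ^ d" and ?r = "dim_col A ^ d"
  have Sub: "S \<subseteq> {..<dim_col A}" "T \<subseteq> {..<?r}" using S T by (auto simp: col_net_def)
  then have fin: "finite S" "finite T" by (auto intro: finite_subset)
  let ?U = "(\<lambda>(s, t). s * ?r + t) ` (S \<times> T)"
  have "card ?U \<le> card (S \<times> T)" using fin by (intro card_image_le) auto
  also have "\<dots> \<le> card S ^ Suc d" using T(2) by (simp add: card_cartesian_product)
  finally have card: "card ?U \<le> card S ^ Suc d" .
  have bound: "s * ?r + t < dim_col A * ?r" if "s < dim_col A" "t < ?r" for s t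
  proof -
    have "s * ?r + t < Suc s * ?r" using that by simp
    also have "\<dots> \<le> dim_col A * ?r" using that by (intro mult_le_mono1) simp
    finally show ?thesis .
  qed
  have "\<exists>u\<in>?U. L2_set (\<lambda>i. ?Y $$ (i, j) - ?Y $$ (i, u)) {..<dim_row A ^ Suc d} \<le> real (Suc d) * \<epsilon>"
    if j: "j < dim_col A ^ Suc d" for j
  proof -
    have j': "j < dim_col A * ?r" using j by simp
    let ?j1 = "j div ?r" and ?j2 = "j mod ?r"
    note jb = div_mod_bounds[OF j']
    obtain s where s: "s \<in> S" "L2_set (\<lambda>i. A $$ (i, ?j1) - A $$ (i, s)) {..<dim_row A} \<le> \<epsilon>"
      using S jb by (auto simp: col_net_def)
    obtain t where t: "t \<in> T" "L2_set (\<lambda>i. ?X $$ (i, ?j2) - ?X $$ (i, t)) {..<?k} \<le> real d * \<epsilon>"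
      using T(1) jb(2) unfolding col_net_def dim_tensor_power by blast
    let ?u = "s * ?r + t"
    have st: "s < dim_col A" "t < ?r" using s t Sub by auto
    have ub: "?u < dim_col A * ?r" using bound st by auto
    have ud: "?u div ?r = s" "?u mod ?r = t" using st by auto
    have "L2_set (\<lambda>i. ?Y $$ (i, j) - ?Y $$ (i, ?u)) {..<dim_row A ^ Suc d}
      = L2_set (\<lambda>i. (A $$ (i div ?k, ?j1) - A $$ (i div ?k, s)) * ?X $$ (i mod ?k, ?j2)
          + A $$ (i div ?k, s) * (?X $$ (i mod ?k, ?j2) - ?X $$ (i mod ?k, t))) {..<dim_row A * ?k}"
      using j' ub ud by (intro L2_set_cong) (auto simp: index_kron algebra_simps)
    also have "\<dots> \<le> L2_set (\<lambda>i. (A $$ (i div ?k, ?j1) - A $$ (i div ?k, s)) * ?X $$ (i mod ?k, ?j2)) {..<dim_row A * ?k}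
         + L2_set (\<lambda>i. A $$ (i div ?k, s) * (?X $$ (i mod ?k, ?j2) - ?X $$ (i mod ?k, t))) {..<dim_row A * ?k}"
      by (rule L2_set_triangle_ineq)
    also have "\<dots> = L2_set (\<lambda>i. A $$ (i, ?j1) - A $$ (i, s)) {..<dim_row A} * L2_set (\<lambda>i. ?X $$ (i, ?j2)) {..<?k}
         + L2_set (\<lambda>i. A $$ (i, s)) {..<dim_row A} * L2_set (\<lambda>i. ?X $$ (i, ?j2) - ?X $$ (i, t)) {..<?k}"
      using L2_set_product[of "\<lambda>i. A $$ (i, ?j1) - A $$ (i, s)" ?k "\<lambda>i. ?X $$ (i, ?j2)" "dim_row A"]
        L2_set_product[of "\<lambda>i. A $$ (i, s)" ?k "\<lambda>i. ?X $$ (i, ?j2) - ?X $$ (i, t)" "dim_row A"] by simp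
    also have "\<dots> \<le> \<epsilon> * 1 + 1 * (real d * \<epsilon>)"
      using s t A[OF st(1)] tensor_power_col_norm[OF A jb(2)]
      by (intro add_mono mult_mono) (auto simp: L2_set_nonneg intro: order_trans[OF L2_set_nonneg])
    finally have "L2_set (\<lambda>i. ?Y $$ (i, j) - ?Y $$ (i, ?u)) {..<dim_row A ^ Suc d} \<le> real (Suc d) * \<epsilon>"
      by (simp add: algebra_simps)
    moreover have "?u \<in> ?U" using s t by (intro image_eqI[of _ _ "(s, t)"]) auto
    ultimately show ?thesis by blast
  qed
  moreover have "?U \<subseteq> {..<dim_col A ^ Suc d}" using bound Sub by auto
  ultimately have "col_net ?Y (real (Suc d) * \<epsilon>) ?U" by (auto simp only: col_net_def dim_tensor_power)
  then show ?case using card by blast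
qed

text \<open>
  The coefficient of a column is passed on to a nearest net column, which moves the combination by
  at most \<open>\<epsilon>\<close>. The rest is the isometry between \<open>n\<close>-space and coordinates.
\<close>

lemma covering_number_absconv_le:
  assumes n: "n = dim_row X" and Q: "Q \<in> carrier_mat n n" "transpose_mat Q * Q = 1\<^sub>m n"
    and S: "col_net X \<epsilon> S" and e: "\<epsilon> \<ge> 0"
    and cov: "covered_by {..<n} (abs_hull S (\<lambda>s i. Matrix.col Q i \<bullet> Matrix.col X s)) \<epsilon>' N"
  shows "real (covering_number n (\<epsilon> + \<epsilon>') (absconv X)) \<le> N"
proof -
  obtain C where C: "finite C" "real (card C) \<le> N"
    "\<And>x. x \<in> abs_hull S (\<lambda>s i. Matrix.col Q i \<bullet> Matrix.col X s) \<Longrightarrow> \<exists>c\<in>C. L2_set (\<lambda>i. x i - c i) {..<n} \<le> \<epsilon>'"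
    using cov by (auto simp: covered_by_def)
  have Sub: "S \<subseteq> {..<dim_col X}" using S by (simp add: col_net_def)
  then have finS: "finite S" by (rule finite_subset) simp
  define z where "z c = Q *\<^sub>v Matrix.vec n c" for c
  have zc: "z c \<in> carrier_vec n" for c using Q by (auto simp: z_def)
  have "covering_number n (\<epsilon> + \<epsilon>') (absconv X) \<le> card (z ` C)"
  proof (rule covering_number_le)
    fix y assume "y \<in> absconv X"
    then obtain \<beta> where \<beta>: "y = X *\<^sub>v \<beta>" "\<beta> \<in> carrier_vec (dim_col X)" "l1norm \<beta> \<le> 1"
      by (auto simp: absconv_def)
    have yc: "y \<in> carrier_vec n" unfolding \<beta>(1) n by (rule carrier_vecI) simp
    have "\<forall>j\<in>{..<dim_col X}. \<exists>s. s \<in> S \<and> L2_set (\<lambda>i. X $$ (i, j) - X $$ (i, s)) {..<n} \<le> \<epsilon>"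
      using S n by (auto simp: col_net_def)
    then obtain p where p: "\<And>j. j < dim_col X \<Longrightarrow> p j \<in> S"
      "\<And>j. j < dim_col X \<Longrightarrow> L2_set (\<lambda>i. X $$ (i, j) - X $$ (i, p j)) {..<n} \<le> \<epsilon>"
      unfolding bchoice_iff by auto
    define b where "b s = (\<Sum>j\<in>{j. j < dim_col X \<and> p j = s}. \<beta> $ j)" for s
    have \<beta>1: "(\<Sum>j<dim_col X. \<bar>\<beta> $ j\<bar>) \<le> 1" using \<beta> by (auto simp: l1norm_def)
    have group: "(\<Sum>s\<in>S. \<Sum>j\<in>{j. j < dim_col X \<and> p j = s}. h j) = (\<Sum>j<dim_col X. h j)" for h :: "nat \<Rightarrow> real"
      using sum.group[of "{..<dim_col X}" S p h] finS p(1) by (auto simp: Collect_conj_eq lessThan_def)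
    have b1: "(\<Sum>s\<in>S. \<bar>b s\<bar>) \<le> 1"
    proof -
      have "(\<Sum>s\<in>S. \<bar>b s\<bar>) \<le> (\<Sum>s\<in>S. \<Sum>j\<in>{j. j < dim_col X \<and> p j = s}. \<bar>\<beta> $ j\<bar>)"
        unfolding b_def by (intro sum_mono sum_abs)
      also have "\<dots> \<le> 1" using group[of "\<lambda>j. \<bar>\<beta> $ j\<bar>"] \<beta>1 by simp
      finally show ?thesis .
    qed
    define y' where "y' = Matrix.vec n (\<lambda>i. \<Sum>s\<in>S. b s * X $$ (i, s))"
    have y'c: "y' \<in> carrier_vec n" by (simp add: y'_def)
    have bp: "(\<Sum>s\<in>S. b s * g s) = (\<Sum>j<dim_col X. \<beta> $ j * g (p j))" for g :: "nat \<Rightarrow> real"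
    proof -
      have "(\<Sum>s\<in>S. b s * g s) = (\<Sum>s\<in>S. \<Sum>j\<in>{j. j < dim_col X \<and> p j = s}. \<beta> $ j * g (p j))"
        unfolding b_def sum_distrib_right by (intro sum.cong) auto
      also have "\<dots> = (\<Sum>j<dim_col X. \<beta> $ j * g (p j))" by (rule group)
      finally show ?thesis .
    qed
    have yy': "L2_set (\<lambda>i. y $ i - y' $ i) {..<n} \<le> \<epsilon>"
    proof -
      let ?d = "\<lambda>i. \<Sum>j\<in>{..<dim_col X}. \<beta> $ j * (X $$ (i, j) - X $$ (i, p j))"
      have "L2_set (\<lambda>i. y $ i - y' $ i) {..<n} = L2_set ?d {..<n}"
      proof (rule L2_set_cong[OF refl])
        fix i assume i: "i \<in> {..<n}"
        have "y $ i = (\<Sum>j<dim_col X. X $$ (i, j) * \<beta> $ j)"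
          using i n \<beta> by (auto simp: scalar_prod_def lessThan_atLeast0 intro!: sum.cong)
        moreover have "y' $ i = (\<Sum>j<dim_col X. \<beta> $ j * X $$ (i, p j))" using i bp by (simp add: y'_def)
        ultimately show "y $ i - y' $ i = ?d i" by (simp add: sum_subtractf algebra_simps)
      qed
      also have "\<dots> \<le> \<epsilon>"
      proof (rule L2_set_abs_hull_le[where S = "{..<dim_col X}" and v = "\<lambda>j i. X $$ (i, j) - X $$ (i, p j)"])
        show "?d \<in> abs_hull {..<dim_col X} (\<lambda>j i. X $$ (i, j) - X $$ (i, p j))"
          unfolding abs_hull_def using \<beta>1 by (intro CollectI exI[of _ "\<lambda>j. \<beta> $ j"]) auto
      qed (use p e in auto)
      finally show ?thesis .
    qed
    let ?x = "\<lambda>i. \<Sum>s\<in>S. b s * (Matrix.col Q i \<bullet> Matrix.col X s)"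
    have "?x \<in> abs_hull S (\<lambda>s i. Matrix.col Q i \<bullet> Matrix.col X s)"
      unfolding abs_hull_def using b1 by auto
    then obtain c where c: "c \<in> C" "L2_set (\<lambda>i. ?x i - c i) {..<n} \<le> \<epsilon>'" using C(3) by blast
    have "L2_set (\<lambda>i. y' $ i - z c $ i) {..<n} = L2_set (\<lambda>i. ?x i - c i) {..<n}"
    proof -
      let ?w = "y' - z c"
      have wc: "?w \<in> carrier_vec n" using y'c zc by auto
      have "(\<Sum>i<n. (y' $ i - z c $ i)\<^sup>2) = ?w \<bullet> ?w"
        unfolding scalar_prod_self using y'c zc[of c] by (intro sum.cong) auto
      also have "\<dots> = (\<Sum>i<n. (Matrix.col Q i \<bullet> ?w)\<^sup>2)" by (rule orthogonal_mat_norm[OF Q wc, symmetric])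
      also have "\<dots> = (\<Sum>i<n. (?x i - c i)\<^sup>2)"
      proof (rule sum.cong[OF refl])
        fix i assume i: "i \<in> {..<n}"
        have qc: "Matrix.col Q i \<in> carrier_vec n" using Q by auto
        have "Matrix.col Q i \<bullet> y' = (\<Sum>a<n. Matrix.col Q i $ a * (\<Sum>s\<in>S. b s * X $$ (a, s)))"
          using i by (auto simp: scalar_prod_def y'_def lessThan_atLeast0)
        also have "\<dots> = (\<Sum>a<n. \<Sum>s\<in>S. b s * (Matrix.col Q i $ a * X $$ (a, s)))"
          by (simp add: sum_distrib_left mult_ac)
        also have "\<dots> = (\<Sum>s\<in>S. \<Sum>a<n. b s * (Matrix.col Q i $ a * X $$ (a, s)))" by (rule sum.swap)
        also have "\<dots> = ?x i"
          unfolding sum_distrib_left[symmetric]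
          using Sub n i by (intro sum.cong) (auto simp: scalar_prod_def lessThan_atLeast0 intro!: sum.cong)
        finally have 1: "Matrix.col Q i \<bullet> y' = ?x i" .
        have "Matrix.col Q i \<bullet> z c = (transpose_mat Q *\<^sub>v (Q *\<^sub>v Matrix.vec n c)) $ i"
          using i Q by (auto simp: z_def)
        also have "transpose_mat Q *\<^sub>v (Q *\<^sub>v Matrix.vec n c) = (transpose_mat Q * Q) *\<^sub>v Matrix.vec n c"
          using Q by (intro assoc_mult_mat_vec[symmetric]) auto
        also have "\<dots> $ i = c i" using Q(2) i by simp
        finally have 2: "Matrix.col Q i \<bullet> z c = c i" .
        show "(Matrix.col Q i \<bullet> ?w)\<^sup>2 = (?x i - c i)\<^sup>2"
          using 1 2 scalar_prod_minus_distrib[OF qc y'c zc] by simp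
      qed
      finally show ?thesis by (simp add: L2_set_def)
    qed
    then have y'z: "L2_set (\<lambda>i. y' $ i - z c $ i) {..<n} \<le> \<epsilon>'" using c by simp
    have "l2dist y (z c) = L2_set (\<lambda>i. (y $ i - y' $ i) + (y' $ i - z c $ i)) {..<n}"
      using l2dist_eq_L2_set[OF yc zc] by simp
    also have "\<dots> \<le> L2_set (\<lambda>i. y $ i - y' $ i) {..<n} + L2_set (\<lambda>i. y' $ i - z c $ i) {..<n}"
      by (rule L2_set_triangle_ineq)
    finally have "l2dist y (z c) \<le> \<epsilon> + \<epsilon>'" using yy' y'z by simp
    then show "\<exists>c\<in>z ` C. l2dist y c \<le> \<epsilon> + \<epsilon>'" using c(1) by blast
  qed (use zc C(1) in auto)
  also have "card (z ` C) \<le> card C" using C(1) by (rule card_image_le)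
  finally show ?thesis using C(2) by simp
qed

section \<open>Uniform asymptotic bounds\<close>

lemma lesssim_onI:
  assumes "\<forall>\<^sub>F \<epsilon> in at_right 0. \<forall>\<Psi>\<in>\<M>. h \<Psi> \<epsilon> \<le> C * g \<epsilon>" and "\<forall>\<^sub>F \<epsilon> in at_right 0. g \<epsilon> > 0"
  shows "lesssim_on \<M> h g"
  unfolding lesssim_on_def
proof (intro exI[of _ C] Limsup_bounded)
  show "\<forall>\<^sub>F \<epsilon> in at_right 0. (SUP \<Psi>\<in>\<M>. ereal (h \<Psi> \<epsilon> / g \<epsilon>)) \<le> ereal C"
    using assms by eventually_elim (auto intro!: SUP_least simp: divide_le_eq)
qed

lemma lesssim_onD:
  assumes "lesssim_on \<M> h g" and "\<forall>\<^sub>F \<epsilon> in at_right 0. g \<epsilon> > 0"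
  shows "\<exists>C\<ge>1. \<forall>\<^sub>F \<epsilon> in at_right 0. \<forall>\<Psi>\<in>\<M>. h \<Psi> \<epsilon> \<le> C * g \<epsilon>"
proof -
  obtain C where C: "Limsup (at_right 0) (\<lambda>\<epsilon>. SUP \<Psi>\<in>\<M>. ereal (h \<Psi> \<epsilon> / g \<epsilon>)) \<le> ereal C"
    using assms(1) by (auto simp: lesssim_on_def)
  define C' where "C' = max 1 (C + 1)"
  have "C < C'" by (simp add: C'_def)
  then have "ereal C < ereal C'" by simp
  then have "Limsup (at_right 0) (\<lambda>\<epsilon>. SUP \<Psi>\<in>\<M>. ereal (h \<Psi> \<epsilon> / g \<epsilon>)) < ereal C'"
    using C by (rule order_le_less_trans[rotated])
  from Limsup_lessD[OF this] assms(2)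
  have "\<forall>\<^sub>F \<epsilon> in at_right 0. \<forall>\<Psi>\<in>\<M>. h \<Psi> \<epsilon> \<le> C' * g \<epsilon>"
  proof eventually_elim
    case (elim \<epsilon>)
    show ?case
    proof
      fix \<Psi> assume "\<Psi> \<in> \<M>"
      then have "ereal (h \<Psi> \<epsilon> / g \<epsilon>) \<le> (SUP \<Psi>\<in>\<M>. ereal (h \<Psi> \<epsilon> / g \<epsilon>))" by (rule SUP_upper)
      then have "ereal (h \<Psi> \<epsilon> / g \<epsilon>) < ereal C'" using elim(1) by (rule order_le_less_trans)
      then show "h \<Psi> \<epsilon> \<le> C' * g \<epsilon>" using elim(2) by (simp add: divide_less_eq)
    qed
  qed
  then show ?thesis by (intro exI[of _ C']) (auto simp: C'_def)
qed

lemma eventually_ln_inverse: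
  assumes "eventually P at_top"
  shows "\<forall>\<^sub>F \<epsilon>::real in at_right 0. P (ln (1 / \<epsilon>))"
proof -
  have "filterlim (\<lambda>\<epsilon>::real. ln (1 / \<epsilon>)) at_top (at_right 0)" by real_asymp
  then show ?thesis using assms by (simp add: filterlim_iff)
qed

text \<open>
  The level is the rounded binary logarithm of the target size. That \<open>B\<close> is chosen before \<open>\<kappa>\<close>
  matters: the factor \<open>\<kappa>\<close> will be chosen in terms of \<open>B\<close>, and it changes the level only by a
  bounded amount.
\<close>

lemma level_choice:
  fixes a b :: real
  assumes a: "a > 0" and b: "b \<ge> 0"
  shows "\<exists>B\<ge>1. \<forall>\<kappa>>0. \<forall>\<^sub>F \<epsilon> in at_right 0. \<exists>K.
    \<kappa> * (\<epsilon> powr (- a) * ln (1 / \<epsilon>) powr b) \<le> 2 ^ K \<and>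
    2 ^ K \<le> 2 * (\<kappa> * (\<epsilon> powr (- a) * ln (1 / \<epsilon>) powr b)) \<and> real (Suc K) \<le> B * ln (1 / \<epsilon>)"
proof -
  define B where "B = max 1 (a / ln 2 + 1)"
  have "\<forall>\<^sub>F \<epsilon> in at_right 0. \<exists>K.
    \<kappa> * (\<epsilon> powr (- a) * ln (1 / \<epsilon>) powr b) \<le> 2 ^ K \<and>
    2 ^ K \<le> 2 * (\<kappa> * (\<epsilon> powr (- a) * ln (1 / \<epsilon>) powr b)) \<and> real (Suc K) \<le> B * ln (1 / \<epsilon>)"
    if \<kappa>: "\<kappa> > 0" for \<kappa>
  proof -
    define f where "f L = ln \<kappa> + a * L + b * ln L" for L :: real
    have "\<forall>\<^sub>F L in at_top. f L / ln 2 + 2 \<le> (a / ln 2 + 1) * L"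
    proof -
      have "((\<lambda>L::real. b * ln L / L) \<longlongrightarrow> 0) at_top" "((\<lambda>L::real. (ln \<kappa> / ln 2 + 2) / L) \<longlongrightarrow> 0) at_top"
        by real_asymp+
      then have "((\<lambda>L::real. b * ln L / L / ln 2 + (ln \<kappa> / ln 2 + 2) / L) \<longlongrightarrow> 0 / ln 2 + 0) at_top"
        by (intro tendsto_intros) auto
      then have "\<forall>\<^sub>F L in at_top. b * ln L / L / ln 2 + (ln \<kappa> / ln 2 + 2) / L < 1"
        by (rule order_tendstoD) simp
      then show ?thesis using eventually_gt_at_top[of 0]
      proof eventually_elim
        case (elim L)
        then have "(b * ln L / L / ln 2 + (ln \<kappa> / ln 2 + 2) / L) * L \<le> 1 * L"
          by (intro mult_right_mono) auto
        moreover have "(b * ln L / L / ln 2 + c / L) * L = b * ln L / ln 2 + c" for c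
          using elim by (simp add: field_simps)
        ultimately have "b * ln L / ln 2 + (ln \<kappa> / ln 2 + 2) \<le> L" by simp
        then show ?case by (simp add: f_def add_divide_distrib distrib_right)
      qed
    qed
    moreover have "\<forall>\<^sub>F L in at_top. f L \<ge> 0"
    proof -
      have "filterlim (\<lambda>L::real. ln \<kappa> + a * L) at_top at_top" using a by real_asymp
      then have "\<forall>\<^sub>F L::real in at_top. ln \<kappa> + a * L \<ge> 0" by (simp add: filterlim_at_top)
      then show ?thesis using eventually_ge_at_top[of 1]
        by eventually_elim (use b in \<open>auto simp: f_def\<close>)
    qed
    ultimately have "\<forall>\<^sub>F L in at_top. f L / ln 2 + 2 \<le> (a / ln 2 + 1) * L \<and> f L \<ge> 0 \<and> L > 0"
      using eventually_gt_at_top[of 0] by eventually_elim auto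
    from eventually_ln_inverse[OF this] have
      "\<forall>\<^sub>F \<epsilon> in at_right 0. (f (ln (1 / \<epsilon>)) / ln 2 + 2 \<le> (a / ln 2 + 1) * ln (1 / \<epsilon>) \<and> f (ln (1 / \<epsilon>)) \<ge> 0 \<and> ln (1 / \<epsilon>) > 0) \<and> \<epsilon> > 0"
      using eventually_at_right_less[of "0::real"] by eventually_elim auto
    then show ?thesis
    proof eventually_elim
      case (elim \<epsilon>)
      let ?L = "ln (1 / \<epsilon>)"
      let ?Y = "\<kappa> * (\<epsilon> powr (- a) * ?L powr b)"
      have Y: "?Y = exp (f ?L)"
      proof -
        have "\<epsilon> powr (- a) = exp (a * ?L)" using elim by (simp add: powr_def ln_div)
        moreover have "?L powr b = exp (b * ln ?L)"
        proof -
          have "?L \<noteq> 0" using elim by (metis less_irrefl)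
          then show ?thesis by (simp only: powr_def if_False)
        qed
        ultimately show ?thesis using \<kappa> by (simp add: f_def exp_add mult.assoc)
      qed
      define y where "y = f ?L / ln 2"
      have y: "y \<ge> 0" using elim by (simp add: y_def)
      have Yy: "?Y = 2 powr y" unfolding Y y_def by (simp add: powr_def)
      define K where "K = nat \<lceil>y\<rceil>"
      have K: "y \<le> real K" "real K \<le> y + 1" using y unfolding K_def by linarith+
      have "?Y \<le> 2 ^ K" unfolding Yy using K by (simp flip: powr_realpow)
      moreover have "2 ^ K \<le> 2 * ?Y"
      proof -
        have "(2::real) ^ K = 2 powr real K" by (simp add: powr_realpow)
        also have "\<dots> \<le> 2 powr (y + 1)" using K by simp
        finally show ?thesis unfolding Yy by (simp add: powr_add)
      qed
      moreover have "real (Suc K) \<le> B * ?L"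
      proof -
        have "real (Suc K) \<le> y + 2" using K by simp
        also have "\<dots> \<le> (a / ln 2 + 1) * ?L" using elim by (simp add: y_def)
        also have "\<dots> \<le> B * ?L" using elim by (intro mult_right_mono) (auto simp: B_def)
        finally show ?thesis .
      qed
      ultimately show ?case by blast
    qed
  qed
  then show ?thesis by (intro exI[of _ B]) (auto simp: B_def)
qed

text \<open>
  The factor \<open>\<kappa>\<close> is such that the error of the cross of level \<open>K\<close> is at most \<open>\<epsilon>\<close> when
  \<open>Suc K\<close> is replaced by its bound \<open>B * ln (1 / \<epsilon>)\<close>.
\<close>

lemma approx_dim_asymptotic:
  fixes W C :: real
  assumes W: "W > 0" and C: "C \<ge> 1"
  shows "\<exists>C'. \<forall>\<^sub>F \<epsilon> in at_right 0. \<forall>X Q J. dim_col X \<ge> 1 \<and> cross_basis X e W C Q J \<longrightarrow>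
    real (approx_dim \<epsilon> X) \<le> C' * (\<epsilon> powr (- W) * ln (1 / \<epsilon>) powr (real e * (2 + W) / 2))"
proof -
  obtain B where B: "B \<ge> 1" and lc: "\<And>\<kappa>. \<kappa> > 0 \<Longrightarrow> \<forall>\<^sub>F \<epsilon> in at_right 0. \<exists>K.
    \<kappa> * (\<epsilon> powr (- W) * ln (1 / \<epsilon>) powr (real e * W / 2)) \<le> 2 ^ K \<and>
    2 ^ K \<le> 2 * (\<kappa> * (\<epsilon> powr (- W) * ln (1 / \<epsilon>) powr (real e * W / 2))) \<and> real (Suc K) \<le> B * ln (1 / \<epsilon>)"
    using level_choice[OF W, of "real e * W / 2"] W by auto
  define \<kappa> where "\<kappa> = (C * B ^ e) powr (W / 2)"
  have CB: "C * B ^ e > 0" using C B by simp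
  have \<kappa>: "\<kappa> > 0" using C B by (auto simp: \<kappa>_def)
  have pos: "\<forall>\<^sub>F \<epsilon>::real in at_right 0. ln (1 / \<epsilon>) > 0"
    by (rule eventually_ln_inverse[OF eventually_gt_at_top])
  show ?thesis
  proof (rule exI[of _ "2 * C * B ^ e * \<kappa>"], use lc[OF \<kappa>] pos eventually_at_right_less[of "0::real"] in eventually_elim)
    case (elim \<epsilon>)
    let ?L = "ln (1 / \<epsilon>)"
    obtain K where K: "\<kappa> * (\<epsilon> powr (- W) * ?L powr (real e * W / 2)) \<le> 2 ^ K"
      "2 ^ K \<le> 2 * (\<kappa> * (\<epsilon> powr (- W) * ?L powr (real e * W / 2)))" "real (Suc K) \<le> B * ?L"
      using elim(1) by blast
    have SK: "real (Suc K ^ e) \<le> B ^ e * ?L powr real e"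
    proof -
      have "real (Suc K ^ e) \<le> (B * ?L) ^ e" using K(3) by (simp add: power_mono)
      then show ?thesis using elim by (simp add: power_mult_distrib powr_realpow)
    qed
    have small: "C * real (Suc K ^ e) * 2 powr (- 2 * real K / W) \<le> \<epsilon>\<^sup>2"
    proof -
      have "2 powr (- 2 * real K / W) = ((2 ^ K) :: real) powr (- 2 / W)"
        by (simp add: powr_realpow[symmetric] powr_powr mult.commute)
      also have "\<dots> \<le> (\<kappa> * (\<epsilon> powr (- W) * ?L powr (real e * W / 2))) powr (- 2 / W)"
        using K(1) W \<kappa> elim by (intro powr_mono2') auto
      also have "\<dots> = (C * B ^ e) powr - 1 * (\<epsilon>\<^sup>2 * ?L powr (- real e))"
      proof -
        have 1: "\<kappa> powr (- 2 / W) = (C * B ^ e) powr - 1"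
          using W unfolding \<kappa>_def powr_powr by simp
        have "(\<epsilon> powr (- W)) powr (- 2 / W) = \<epsilon> powr (real 2)" using W by (simp add: powr_powr)
        also have "\<dots> = \<epsilon>\<^sup>2" using elim by (intro powr_realpow) simp
        finally have 2: "(\<epsilon> powr (- W)) powr (- 2 / W) = \<epsilon>\<^sup>2" .
        have 3: "(?L powr (real e * W / 2)) powr (- 2 / W) = ?L powr (- real e)"
          using W unfolding powr_powr by simp
        show ?thesis unfolding 1[symmetric] 2[symmetric] 3[symmetric]
          using \<kappa> by (simp only: powr_mult powr_ge_zero less_imp_le mult_nonneg_nonneg)
      qed
      finally have "C * real (Suc K ^ e) * 2 powr (- 2 * real K / W)
        \<le> C * (B ^ e * ?L powr real e) * ((C * B ^ e) powr - 1 * (\<epsilon>\<^sup>2 * ?L powr (- real e)))"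
        using SK C B by (intro mult_mono) auto
      also have "\<dots> = ((C * B ^ e) * (C * B ^ e) powr - 1) * \<epsilon>\<^sup>2 * (?L powr real e * ?L powr (- real e))"
        by (simp add: mult_ac)
      also have "(C * B ^ e) * (C * B ^ e) powr - 1 = 1"
      proof -
        have "y * y powr - 1 = 1" if "y > 0" for y :: real using that by (simp add: powr_minus)
        then show ?thesis using CB .
      qed
      also have "?L powr real e * ?L powr (- real e) = 1" using elim by (simp add: powr_minus)
      finally show ?thesis by simp
    qed
    show ?case
    proof (intro allI impI, elim conjE)
      fix X Q J assume X: "dim_col X \<ge> 1" and c: "cross_basis X e W C Q J"
      have "approx_dim \<epsilon> X \<le> card (J K)"
      proof (rule approx_dim_le[OF X refl])
        show "(\<Sum>i\<in>{..<dim_row X} - J K. (Matrix.col Q i \<bullet> Matrix.col X j)\<^sup>2) \<le> \<epsilon>\<^sup>2" if "j < dim_col X" for j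
          using c that small unfolding cross_basis_def by (meson order_trans)
      qed (use c elim in \<open>auto simp: cross_basis_def\<close>)
      then have "real (approx_dim \<epsilon> X) \<le> real (card (J K))" by simp
      also have "\<dots> \<le> C * real (Suc K ^ e) * 2 ^ K" using c by (simp add: cross_basis_def)
      also have "\<dots> \<le> C * (B ^ e * ?L powr real e) * (2 * (\<kappa> * (\<epsilon> powr (- W) * ?L powr (real e * W / 2))))"
        using SK K(2) C B by (intro mult_mono) auto
      also have "\<dots> = (2 * C * B ^ e * \<kappa>) * (\<epsilon> powr (- W) * (?L powr real e * ?L powr (real e * W / 2)))"
        by (simp add: mult_ac)
      also have "?L powr real e * ?L powr (real e * W / 2) = ?L powr (real e * (2 + W) / 2)"
        by (simp add: powr_add[symmetric] field_simps)
      finally show "real (approx_dim \<epsilon> X) \<le> 2 * C * B ^ e * \<kappa> * (\<epsilon> powr (- W) * ?L powr (real e * (2 + W) / 2))" .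
    qed
  qed
qed

text \<open>
  With these radii, \<open>(\<delta> k / \<rho> k)\<^sup>2 * \<Lambda>\<close> is exactly the dimension bound \<open>D k\<close> of the
  \<open>k\<close>-th cross: the entropy of the part outside the cross and that of the part inside balance.
\<close>

lemma covered_by_cross:
  fixes W C \<Lambda> :: real
  assumes W: "W > 0" and c: "cross_basis X e W C Q J" and C: "C \<ge> 1"
    and norm: "\<And>j. j < dim_col X \<Longrightarrow> L2_set (\<lambda>i. X $$ (i, j)) {..<dim_row X} \<le> 1"
    and S: "S \<subseteq> {..<dim_col X}" "S \<noteq> {}" and \<Lambda>: "\<Lambda> \<ge> 1" "ln (2 * card S) \<le> \<Lambda>"
  shows "covered_by {..<dim_row X} (abs_hull S (\<lambda>s i. Matrix.col Q i \<bullet> Matrix.col X s))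
     (sqrt \<Lambda> * 2 powr (- real K * (1 / W + 1 / 2)))
     (exp ((2 * 2 powr (1 / W + 1 / 2) * ln 2 + ln 3 + 32) * (2 * C * real (Suc K ^ e) * 2 ^ K)))"
proof -
  let ?n = "dim_row X"
  define w where "w = 1 / W + 1 / 2"
  define \<rho> where "\<rho> k = sqrt \<Lambda> * 2 powr (- real k * w)" for k
  define D where "D k = C * real (Suc k ^ e) * 2 ^ k" for k
  define \<delta> where "\<delta> k = sqrt (C * real (Suc k ^ e) * 2 powr (- 2 * real k / W))" for k
  let ?v = "\<lambda>s i. Matrix.col Q i \<bullet> Matrix.col X s"
  let ?A = "2 * 2 powr w"
  have Q: "Q \<in> carrier_mat ?n ?n" "transpose_mat Q * Q = 1\<^sub>m ?n" using c by (auto simp: cross_basis_def)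
  have \<rho>0: "\<rho> k > 0" for k using \<Lambda> by (simp add: \<rho>_def)
  have "covered_by {..<?n} (abs_hull S ?v) (\<rho> K) (exp ((?A * ln 2 + ln 3 + 32) * (\<Sum>k\<le>K. D k)))"
  proof (rule covered_by_abs_hull_chain[where J = J and \<delta> = \<delta> and \<Lambda> = \<Lambda>])
    show "finite S" using S(1) by (rule finite_subset) simp
    show "L2_set (?v s) {..<?n} \<le> \<rho> 0" if s: "s \<in> S" for s
    proof -
      have xc: "Matrix.col X s \<in> carrier_vec ?n" by simp
      have "L2_set (?v s) {..<?n} = sqrt (Matrix.col X s \<bullet> Matrix.col X s)"
        unfolding L2_set_def using orthogonal_mat_norm[OF Q xc] by simp
      also have "\<dots> = L2_set (\<lambda>i. X $$ (i, s)) {..<?n}"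
        using s S(1) unfolding L2_set_def scalar_prod_self by (auto intro!: sum.cong)
      also have "\<dots> \<le> 1" using norm s S(1) by auto
      also have "1 \<le> \<rho> 0" using \<Lambda> by (simp add: \<rho>_def)
      finally show ?thesis .
    qed
    show "J k \<subseteq> {..<?n}" "real (card (J k)) \<le> D k" for k using c by (auto simp: cross_basis_def D_def)
    show "L2_set (?v s) ({..<?n} - J k) \<le> \<delta> k" if s: "s \<in> S" for k s
      unfolding L2_set_def \<delta>_def using c s S(1) by (intro real_sqrt_le_mono) (auto simp: cross_basis_def)
    show "\<delta> k \<ge> 0" for k using C by (simp add: \<delta>_def)
    show "2 * \<rho> k \<le> ?A * \<rho> (Suc k)" for k
    proof -
      have "2 powr w * 2 powr (- real (Suc k) * w) = 2 powr (- real k * w)"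
        by (simp add: powr_add[symmetric] algebra_simps)
      then show ?thesis by (simp add: \<rho>_def mult_ac)
    qed
    show "32 * (\<delta> k / \<rho> k)\<^sup>2 * \<Lambda> \<le> 32 * D k" for k
    proof -
      have "(\<delta> k)\<^sup>2 = C * real (Suc k ^ e) * 2 powr (- 2 * real k / W)" using C by (simp add: \<delta>_def)
      moreover have "(\<rho> k)\<^sup>2 = \<Lambda> * 2 powr (- 2 * real k * w)" using \<Lambda>
        by (simp add: \<rho>_def power_mult_distrib) (simp add: power2_eq_square powr_add[symmetric] algebra_simps)
      moreover have "2 powr (- 2 * real k / W) = 2 powr (- 2 * real k * w) * 2 ^ k"
        by (simp add: powr_realpow[symmetric] powr_add[symmetric] w_def algebra_simps add_divide_distrib)
      ultimately have "(\<delta> k / \<rho> k)\<^sup>2 * \<Lambda> = D k" using \<Lambda>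
        by (simp add: power_divide D_def)
      then show ?thesis by simp
    qed
  qed (use S \<rho>0 \<Lambda> in auto)
  then show ?thesis
  proof (rule covered_by_mono)
    have "(\<Sum>k\<le>K. D k) \<le> (\<Sum>k\<le>K. C * real (Suc K ^ e) * 2 ^ k)"
      unfolding D_def using C by (intro sum_mono mult_right_mono mult_left_mono of_nat_mono power_mono) auto
    also have "\<dots> = C * real (Suc K ^ e) * (\<Sum>k\<le>K. 2 ^ k)" by (rule sum_distrib_left[symmetric])
    also have "(\<Sum>k\<le>K. (2::real) ^ k) \<le> 2 * 2 ^ K" by (induction K) auto
    finally have "(\<Sum>k\<le>K. D k) \<le> 2 * C * real (Suc K ^ e) * 2 ^ K"
      using C by (simp add: mult_left_mono mult_ac)
    then show "exp ((?A * ln 2 + ln 3 + 32) * (\<Sum>k\<le>K. D k))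
      \<le> exp ((2 * 2 powr (1 / W + 1 / 2) * ln 2 + ln 3 + 32) * (2 * C * real (Suc K ^ e) * 2 ^ K))"
      unfolding w_def by (auto intro!: mult_left_mono add_nonneg_nonneg)
  qed (simp add: \<rho>_def w_def)
qed

text \<open>
  Half of \<open>\<epsilon>\<close> is spent on the net of the columns, half on the chain of covers, whose last radius
  determines \<open>K\<close>.
\<close>

lemma entropy_asymptotic:
  fixes W C \<Lambda>1 :: real
  assumes W: "W > 0" and C: "C \<ge> 1" and \<Lambda>1: "\<Lambda>1 > 0"
  shows "\<exists>C'. \<forall>\<^sub>F \<epsilon> in at_right 0. \<forall>X Q J S. cross_basis X e W C Q J \<and>
     (\<forall>j<dim_col X. L2_set (\<lambda>i. X $$ (i, j)) {..<dim_row X} \<le> 1) \<and>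
     col_net X (\<epsilon> / 2) S \<and> S \<noteq> {} \<and> ln (2 * card S) \<le> \<Lambda>1 * ln (1 / \<epsilon>) \<longrightarrow>
     entropy (dim_row X) \<epsilon> (absconv X) \<le> C' * (\<epsilon> powr (- (2 * W / (2 + W))) * ln (1 / \<epsilon>) ^ e
              * ln (1 / \<epsilon>) powr (W / (2 + W)))"
proof -
  define a where "a = 2 * W / (2 + W)"
  have a: "a > 0" "W / (2 + W) = a / 2" using W by (auto simp: a_def field_simps)
  obtain B where B: "B \<ge> 1" and lc: "\<And>\<kappa>. \<kappa> > 0 \<Longrightarrow> \<forall>\<^sub>F \<epsilon> in at_right 0. \<exists>K.
    \<kappa> * (\<epsilon> powr (- a) * ln (1 / \<epsilon>) powr (a / 2)) \<le> 2 ^ K \<and>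
    2 ^ K \<le> 2 * (\<kappa> * (\<epsilon> powr (- a) * ln (1 / \<epsilon>) powr (a / 2))) \<and> real (Suc K) \<le> B * ln (1 / \<epsilon>)"
    using level_choice[of a "a / 2"] a by auto
  \<comment> \<open>obtained by solving \<open>\<rho> K = \<epsilon> / 2\<close> for \<open>2 ^ K\<close>\<close>
  define \<kappa> where "\<kappa> = (4 * \<Lambda>1) powr (a / 2)"
  have \<kappa>: "\<kappa> > 0" using \<Lambda>1 by (simp add: \<kappa>_def)
  define c0 where "c0 = 2 * 2 powr (1 / W + 1 / 2) * ln 2 + ln (3::real) + 32"
  have c0: "c0 \<ge> 0" by (auto simp: c0_def intro!: add_nonneg_nonneg)
  have big: "\<forall>\<^sub>F \<epsilon>::real in at_right 0. ln (1 / \<epsilon>) > 0 \<and> ln (1 / \<epsilon>) \<ge> 1 / \<Lambda>1"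
    by (rule eventually_ln_inverse[where P = "\<lambda>L. L > 0 \<and> L \<ge> 1 / \<Lambda>1"])
       (intro eventually_conj eventually_gt_at_top eventually_ge_at_top)
  show ?thesis
  proof (rule exI[of _ "c0 * 2 * C * B ^ e * 2 * \<kappa>"], use lc[OF \<kappa>] big eventually_at_right_less[of "0::real"] in eventually_elim)
    case (elim \<epsilon>)
    let ?L = "ln (1 / \<epsilon>)"
    let ?Y = "\<kappa> * (\<epsilon> powr (- a) * ?L powr (a / 2))"
    obtain K where K: "?Y \<le> 2 ^ K" "2 ^ K \<le> 2 * ?Y" "real (Suc K) \<le> B * ?L"
      using elim(1) by blast
    have L: "?L > 0" "\<Lambda>1 * ?L \<ge> 1" using elim \<Lambda>1 by (auto simp: field_simps)
    have \<rho>: "sqrt (\<Lambda>1 * ?L) * 2 powr (- real K * (1 / W + 1 / 2)) \<le> \<epsilon> / 2"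
    proof -
      have "- real K * (1 / W + 1 / 2) = real K * (- 1 / a)" using W by (simp add: a_def field_simps)
      then have "2 powr (- real K * (1 / W + 1 / 2)) = ((2 ^ K) :: real) powr (- 1 / a)"
        by (simp add: powr_realpow[symmetric] powr_powr)
      also have "\<dots> \<le> ?Y powr (- 1 / a)" using K(1) a L \<kappa> elim by (intro powr_mono2') auto
      also have "\<dots> = (4 * \<Lambda>1) powr (- 1 / 2) * (\<epsilon> * ?L powr (- 1 / 2))"
      proof -
        have "\<kappa> powr (- 1 / a) = (4 * \<Lambda>1) powr (- 1 / 2)" using a by (simp add: \<kappa>_def powr_powr)
        then show ?thesis using a \<kappa> elim by (simp add: powr_mult powr_powr)
      qed
      also have "\<dots> = \<epsilon> * (4 * (\<Lambda>1 * ?L)) powr (- (1 / 2))"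
        using \<Lambda>1 L by (simp add: powr_mult mult_ac)
      also have "\<dots> = \<epsilon> / (2 * sqrt (\<Lambda>1 * ?L))"
      proof -
        have x: "4 * (\<Lambda>1 * ?L) \<ge> 0" using L by linarith
        have "(4 * (\<Lambda>1 * ?L)) powr (- (1 / 2)) = inverse (sqrt (4 * (\<Lambda>1 * ?L)))"
          by (simp only: powr_minus powr_half_sqrt[OF x])
        then show ?thesis by (simp only: real_sqrt_mult[of 4] real_sqrt_four divide_inverse)
      qed
      finally have "sqrt (\<Lambda>1 * ?L) * 2 powr (- real K * (1 / W + 1 / 2)) \<le> sqrt (\<Lambda>1 * ?L) * (\<epsilon> / (2 * sqrt (\<Lambda>1 * ?L)))"
        using L by (intro mult_left_mono) auto
      also have "\<dots> = \<epsilon> / 2"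
      proof -
        have *: "s * (\<epsilon> / (2 * s)) = \<epsilon> / 2" if "s > 0" for s :: real using that by simp
        have "\<Lambda>1 * ?L > 0" using L by linarith
        then show ?thesis by (intro * real_sqrt_gt_zero)
      qed
      finally show ?thesis .
    qed
    have SK: "real (Suc K ^ e) \<le> B ^ e * ?L ^ e"
      using power_mono[OF K(3), of e] by (simp add: power_mult_distrib)
    show ?case
    proof (intro allI impI, elim conjE)
      fix X Q J S
      assume c: "cross_basis X e W C Q J" and norm: "\<forall>j<dim_col X. L2_set (\<lambda>i. X $$ (i, j)) {..<dim_row X} \<le> 1"
        and S: "col_net X (\<epsilon> / 2) S" "S \<noteq> {}" "ln (2 * card S) \<le> \<Lambda>1 * ?L"
      let ?E = "c0 * (2 * C * real (Suc K ^ e) * 2 ^ K)"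
      have Q: "Q \<in> carrier_mat (dim_row X) (dim_row X)" "transpose_mat Q * Q = 1\<^sub>m (dim_row X)"
        using c by (auto simp: cross_basis_def)
      have "covered_by {..<dim_row X} (abs_hull S (\<lambda>s i. Matrix.col Q i \<bullet> Matrix.col X s)) (\<epsilon> / 2) (exp ?E)"
        by (rule covered_by_mono[OF covered_by_cross[OF W c C, where \<Lambda> = "\<Lambda>1 * ?L" and K = K] \<rho>])
           (use norm S L in \<open>auto simp: col_net_def c0_def\<close>)
      from covering_number_absconv_le[OF refl Q S(1) _ this]
      have N: "real (covering_number (dim_row X) \<epsilon> (absconv X)) \<le> exp ?E" using elim by simp
      have "entropy (dim_row X) \<epsilon> (absconv X) \<le> ?E"
      proof (cases "covering_number (dim_row X) \<epsilon> (absconv X) = 0")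
        case True
        then show ?thesis using c0 C by (simp add: entropy_def)
      next
        case False
        then have "ln (real (covering_number (dim_row X) \<epsilon> (absconv X))) \<le> ln (exp ?E)"
          by (intro ln_mono N) auto
        then show ?thesis unfolding entropy_def by (simp only: ln_exp)
      qed
      also have "?E \<le> c0 * (2 * C * (B ^ e * ?L ^ e) * (2 * ?Y))"
        using SK K(2) C c0 B L by (intro mult_mono) auto
      also have "\<dots> = c0 * 2 * C * B ^ e * 2 * \<kappa> * (\<epsilon> powr (- a) * ?L ^ e * ?L powr (a / 2))"
        by (simp add: mult_ac)
      finally show "entropy (dim_row X) \<epsilon> (absconv X) \<le> c0 * 2 * C * B ^ e * 2 * \<kappa> * (\<epsilon> powr (- (2 * W / (2 + W))) * ?L ^ e
              * ?L powr (W / (2 + W)))"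
        unfolding a(2) a_def[symmetric] .
    qed
  qed
qed

lemma tensor_power_net:
  assumes "\<epsilon> > 0" "d \<ge> 1" and "\<And>j. j < dim_col \<Psi> \<Longrightarrow> L2_set (\<lambda>i. \<Psi> $$ (i, j)) {..<dim_row \<Psi>} \<le> 1"
  shows "\<exists>T. col_net (tensor_power \<Psi> d) \<epsilon> T \<and> card T \<le> covering_cols (\<epsilon> / (2 * real d)) \<Psi> ^ d"
proof -
  let ?\<delta> = "\<epsilon> / (2 * real d)"
  obtain S where S: "col_net \<Psi> (2 * ?\<delta>) S" "card S \<le> covering_cols ?\<delta> \<Psi>"
    using col_net_exists[of ?\<delta> \<Psi>] assms by auto
  obtain T where T: "col_net (tensor_power \<Psi> d) (real d * (2 * ?\<delta>)) T" "card T \<le> card S ^ d"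
    using col_net_tensor_power[OF assms(3) S(1)] by blast
  have "real d * (2 * ?\<delta>) = \<epsilon>" using assms by simp
  then show ?thesis using T S(2) by (metis order_trans power_mono zero_le)
qed

section \<open>The bounds for tensor powers\<close>

theorem corollary4p1:
  fixes d q :: nat and \<gamma> W :: real and \<M> :: "real Matrix.mat set"
  assumes "d \<ge> 2" and "q \<ge> 1" and "\<gamma> > 0" and "W > 0"
    and "\<And>\<Psi>. \<Psi> \<in> \<M> \<Longrightarrow> dim_row \<Psi> \<ge> 1 \<and> dim_col \<Psi> \<ge> 1"
    and "\<And>\<Psi>. \<Psi> \<in> \<M> \<Longrightarrow> Max ((\<lambda>j. l2norm (Matrix.col \<Psi> j)) ` {..<dim_col \<Psi>}) \<le> 1"
    and "\<And>\<Psi>. \<Psi> \<in> \<M> \<Longrightarrow> \<exists>V. nested_approximations \<Psi> q \<gamma> W V"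
  shows
    "lesssim_on \<M> (\<lambda>\<Psi> \<epsilon>. real (approx_dim \<epsilon> (tensor_power \<Psi> d)))
       (\<lambda>\<epsilon>. \<epsilon> powr (- W) * ln (1 / \<epsilon>) powr ((real d - 1) * (2 + W) / 2))
     \<and>
     (\<forall>V::real.
       lesssim_on \<M> (\<lambda>\<Psi> \<epsilon>. real (covering_cols \<epsilon> \<Psi>)) (\<lambda>\<epsilon>. \<epsilon> powr (- V))
       \<longrightarrow>
       lesssim_on \<M> (\<lambda>\<Psi> \<epsilon>. real (covering_cols \<epsilon> (tensor_power \<Psi> d)))
         (\<lambda>\<epsilon>. \<epsilon> powr (- (real d * V)))
       \<and>
       lesssim_on \<M> (\<lambda>\<Psi> \<epsilon>. entropy (dim_row (tensor_power \<Psi> d)) \<epsilon> (absconv (tensor_power \<Psi> d)))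
         (\<lambda>\<epsilon>. \<epsilon> powr (- (2 * W / (2 + W))) * ln (1 / \<epsilon>) ^ (d - 1)
              * ln (1 / \<epsilon>) powr (W / (2 + W))))"
proof -
  have d: "d \<ge> 1" "real d - 1 = real (d - 1)" using assms(1) by auto
  have colnorm: "l2norm (Matrix.col \<Psi> j) \<le> 1" if "\<Psi> \<in> \<M>" "j < dim_col \<Psi>" for \<Psi> j
  proof -
    have "l2norm (Matrix.col \<Psi> j) \<le> Max ((\<lambda>j. l2norm (Matrix.col \<Psi> j)) ` {..<dim_col \<Psi>})"
      using that(2) by (intro Max_ge) auto
    also have "\<dots> \<le> 1" by (rule assms(6)[OF that(1)])
    finally show ?thesis .
  qed
  have norm: "L2_set (\<lambda>i. \<Psi> $$ (i, j)) {..<dim_row \<Psi>} \<le> 1" if "\<Psi> \<in> \<M>" "j < dim_col \<Psi>" for \<Psi> j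
  proof -
    have "L2_set (\<lambda>i. \<Psi> $$ (i, j)) {..<dim_row \<Psi>} = l2norm (Matrix.col \<Psi> j)"
      unfolding l2norm_eq_L2_set using that by (intro L2_set_cong) auto
    then show ?thesis using colnorm[OF that] by simp
  qed
  have tdim: "dim_col (tensor_power \<Psi> d) \<ge> 1" if "\<Psi> \<in> \<M>" for \<Psi>
    using assms(5)[OF that] by (simp add: Suc_le_eq)
  obtain C where C: "C \<ge> 1" and "\<forall>\<Psi> V. dim_row \<Psi> \<ge> 1 \<and> (\<forall>j<dim_col \<Psi>. l2norm (Matrix.col \<Psi> j) \<le> 1)
      \<and> nested_approximations \<Psi> q \<gamma> W V \<longrightarrow> (\<exists>Q J. cross_basis (tensor_power \<Psi> d) (d - 1) W C Q J)"
    using hyperbolic_cross[OF d(1) assms(2,3,4)] by blast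
  then have cross: "\<exists>Q J. cross_basis (tensor_power \<Psi> d) (d - 1) W C Q J" if "\<Psi> \<in> \<M>" for \<Psi>
    using assms(5,7)[OF that] colnorm[OF that] by blast
  have lnpos: "\<forall>\<^sub>F \<epsilon>::real in at_right 0. ln (1 / \<epsilon>) > 0"
    by (rule eventually_ln_inverse[OF eventually_gt_at_top])
  note epos = eventually_at_right_less[of "0::real"]

  have "lesssim_on \<M> (\<lambda>\<Psi> \<epsilon>. real (approx_dim \<epsilon> (tensor_power \<Psi> d)))
       (\<lambda>\<epsilon>. \<epsilon> powr (- W) * ln (1 / \<epsilon>) powr ((real d - 1) * (2 + W) / 2))"
  proof -
    obtain C' where C': "\<forall>\<^sub>F \<epsilon> in at_right 0. \<forall>X Q J. dim_col X \<ge> 1 \<and> cross_basis X (d - 1) W C Q J \<longrightarrow>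
        real (approx_dim \<epsilon> X) \<le> C' * (\<epsilon> powr (- W) * ln (1 / \<epsilon>) powr (real (d - 1) * (2 + W) / 2))"
      using approx_dim_asymptotic[OF assms(4) C] by blast
    show ?thesis unfolding d(2)
    proof (rule lesssim_onI)
      show "\<forall>\<^sub>F \<epsilon> in at_right 0. \<forall>\<Psi>\<in>\<M>. real (approx_dim \<epsilon> (tensor_power \<Psi> d))
          \<le> C' * (\<epsilon> powr (- W) * ln (1 / \<epsilon>) powr (real (d - 1) * (2 + W) / 2))"
        using C' by eventually_elim (use cross tdim in blast)
      show "\<forall>\<^sub>F \<epsilon> in at_right 0. 0 < \<epsilon> powr (- W) * ln (1 / \<epsilon>) powr (real (d - 1) * (2 + W) / 2)"
        using lnpos epos by eventually_elim auto
    qed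
  qed
  moreover have "lesssim_on \<M> (\<lambda>\<Psi> \<epsilon>. real (covering_cols \<epsilon> (tensor_power \<Psi> d))) (\<lambda>\<epsilon>. \<epsilon> powr (- (real d * V)))
    \<and> lesssim_on \<M> (\<lambda>\<Psi> \<epsilon>. entropy (dim_row (tensor_power \<Psi> d)) \<epsilon> (absconv (tensor_power \<Psi> d)))
         (\<lambda>\<epsilon>. \<epsilon> powr (- (2 * W / (2 + W))) * ln (1 / \<epsilon>) ^ (d - 1) * ln (1 / \<epsilon>) powr (W / (2 + W)))"
    if V: "lesssim_on \<M> (\<lambda>\<Psi> \<epsilon>. real (covering_cols \<epsilon> \<Psi>)) (\<lambda>\<epsilon>. \<epsilon> powr (- V))" for V :: real
  proof -
    have "\<forall>\<^sub>F \<epsilon>::real in at_right 0. \<epsilon> powr (- V) > 0" using epos by eventually_elim auto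
    from lesssim_onD[OF V this] obtain C1 where C1: "C1 \<ge> 1"
      and ev: "\<forall>\<^sub>F \<epsilon> in at_right 0. \<forall>\<Psi>\<in>\<M>. real (covering_cols \<epsilon> \<Psi>) \<le> C1 * \<epsilon> powr (- V)" by blast
    then obtain b where b: "b > 0"
      "\<And>\<epsilon> \<Psi>. 0 < \<epsilon> \<Longrightarrow> \<epsilon> < b \<Longrightarrow> \<Psi> \<in> \<M> \<Longrightarrow> real (covering_cols \<epsilon> \<Psi>) \<le> C1 * \<epsilon> powr (- V)"
      unfolding eventually_at_right_field by blast
    define A where "A = (C1 * (2 * real d) powr V) ^ d"
    have A: "A > 0" using C1 d by (simp add: A_def)
    have net: "\<exists>T. col_net (tensor_power \<Psi> d) \<epsilon> T \<and> real (card T) \<le> A * \<epsilon> powr (- (real d * V))"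
      if \<Psi>: "\<Psi> \<in> \<M>" and e: "0 < \<epsilon>" "\<epsilon> < b" for \<Psi> \<epsilon>
    proof -
      let ?\<delta> = "\<epsilon> / (2 * real d)"
      obtain T where T: "col_net (tensor_power \<Psi> d) \<epsilon> T" "card T \<le> covering_cols ?\<delta> \<Psi> ^ d"
        using tensor_power_net[OF e(1) d(1) norm[OF \<Psi>]] by blast
      have "real (card T) \<le> real (covering_cols ?\<delta> \<Psi>) ^ d" using T(2) by (metis of_nat_le_iff of_nat_power)
      also have "\<dots> \<le> (C1 * ?\<delta> powr (- V)) ^ d"
      proof (intro power_mono b(2) \<Psi>)
        have "?\<delta> \<le> \<epsilon>" using e d by (simp add: divide_le_eq mult_le_cancel_left1)
        then show "?\<delta> < b" using e by simp
      qed (use e d in auto)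
      also have "?\<delta> powr (- V) = (2 * real d) powr V * \<epsilon> powr (- V)"
      proof -
        have "?\<delta> powr (- V) = \<epsilon> powr (- V) / (2 * real d) powr (- V)" by (rule powr_divide)
        also have "\<dots> = (2 * real d) powr V * \<epsilon> powr (- V)"
          by (simp only: powr_minus divide_inverse inverse_inverse_eq mult.commute)
        finally show ?thesis .
      qed
      also have "(C1 * ((2 * real d) powr V * \<epsilon> powr (- V))) ^ d = A * (\<epsilon> powr (- V)) ^ d"
        by (simp add: A_def power_mult_distrib mult_ac)
      also have "(\<epsilon> powr (- V)) ^ d = \<epsilon> powr (- (real d * V))"
        using e by (simp add: powr_realpow[symmetric] powr_powr mult.commute)
      finally show ?thesis using T(1) by blast
    qed
    have "lesssim_on \<M> (\<lambda>\<Psi> \<epsilon>. real (covering_cols \<epsilon> (tensor_power \<Psi> d))) (\<lambda>\<epsilon>. \<epsilon> powr (- (real d * V)))"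
    proof (rule lesssim_onI)
      have "real (covering_cols \<epsilon> (tensor_power \<Psi> d)) \<le> A * \<epsilon> powr (- (real d * V))"
        if "0 < \<epsilon>" "\<epsilon> < b" "\<Psi> \<in> \<M>" for \<epsilon> \<Psi>
        using net[OF that(3,1,2)] covering_cols_le of_nat_mono order_trans by metis
      then show "\<forall>\<^sub>F \<epsilon> in at_right 0. \<forall>\<Psi>\<in>\<M>. real (covering_cols \<epsilon> (tensor_power \<Psi> d)) \<le> A * \<epsilon> powr (- (real d * V))"
        using b(1) unfolding eventually_at_right_field by blast
      show "\<forall>\<^sub>F \<epsilon>::real in at_right 0. 0 < \<epsilon> powr (- (real d * V))" using epos by eventually_elim auto
    qed
    moreover have "lesssim_on \<M> (\<lambda>\<Psi> \<epsilon>. entropy (dim_row (tensor_power \<Psi> d)) \<epsilon> (absconv (tensor_power \<Psi> d)))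
         (\<lambda>\<epsilon>. \<epsilon> powr (- (2 * W / (2 + W))) * ln (1 / \<epsilon>) ^ (d - 1) * ln (1 / \<epsilon>) powr (W / (2 + W)))"
    proof -
      \<comment> \<open>The logarithm of the size of the net is at most \<open>d * V * ln (1 / \<epsilon>)\<close> plus the constant
        \<open>c\<close>; the 1 absorbs this constant. The exponent \<open>V\<close> may have either sign.\<close>
      define \<Lambda>1 where "\<Lambda>1 = \<bar>real d * V\<bar> + 1"
      have \<Lambda>1: "\<Lambda>1 > 0" by (simp add: \<Lambda>1_def)
      define c where "c = ln (2 * A) + real d * V * ln 2"
      obtain C' where C': "\<forall>\<^sub>F \<epsilon> in at_right 0. \<forall>X Q J S. cross_basis X (d - 1) W C Q J \<and>
         (\<forall>j<dim_col X. L2_set (\<lambda>i. X $$ (i, j)) {..<dim_row X} \<le> 1) \<and>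
         col_net X (\<epsilon> / 2) S \<and> S \<noteq> {} \<and> ln (2 * card S) \<le> \<Lambda>1 * ln (1 / \<epsilon>) \<longrightarrow>
         entropy (dim_row X) \<epsilon> (absconv X) \<le> C' * (\<epsilon> powr (- (2 * W / (2 + W))) * ln (1 / \<epsilon>) ^ (d - 1)
              * ln (1 / \<epsilon>) powr (W / (2 + W)))"
        using entropy_asymptotic[OF assms(4) C \<Lambda>1, of "d - 1"] by blast
      have big: "\<forall>\<^sub>F \<epsilon>::real in at_right 0. ln (1 / \<epsilon>) \<ge> c"
        by (rule eventually_ln_inverse[OF eventually_ge_at_top])
      have small: "\<forall>\<^sub>F \<epsilon>::real in at_right 0. \<epsilon> < b" 
        using b(1) unfolding eventually_at_right_field by blast
      show ?thesis
      proof (rule lesssim_onI)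
        show "\<forall>\<^sub>F \<epsilon> in at_right 0. \<forall>\<Psi>\<in>\<M>. entropy (dim_row (tensor_power \<Psi> d)) \<epsilon> (absconv (tensor_power \<Psi> d))
          \<le> C' * (\<epsilon> powr (- (2 * W / (2 + W))) * ln (1 / \<epsilon>) ^ (d - 1) * ln (1 / \<epsilon>) powr (W / (2 + W)))"
          using C' big small epos lnpos
        proof eventually_elim
          case (elim \<epsilon>)
          show ?case
          proof
            fix \<Psi> assume \<Psi>: "\<Psi> \<in> \<M>"
            let ?X = "tensor_power \<Psi> d"
            obtain T where T: "col_net ?X (\<epsilon> / 2) T" "real (card T) \<le> A * (\<epsilon> / 2) powr (- (real d * V))"
              using net[OF \<Psi>, of "\<epsilon> / 2"] elim by auto
            have T0: "T \<noteq> {}" using T(1) tdim[OF \<Psi>] unfolding col_net_def by (metis One_nat_def Suc_le_eq empty_iff)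
            have "finite T" using T(1) finite_subset[of T "{..<dim_col ?X}"] by (auto simp: col_net_def)
            then have cT: "card T > 0" using T0 by (simp add: card_gt_0_iff)
            have "ln (2 * card T) \<le> ln (2 * (A * (\<epsilon> / 2) powr (- (real d * V))))"
              using T(2) cT A elim by (subst ln_le_cancel_iff) auto
            also have "\<dots> = ln (2 * A) + (- (real d * V)) * ln (\<epsilon> / 2)"
              using A elim by (simp add: ln_mult ln_powr)
            also have "\<dots> = c + real d * V * ln (1 / \<epsilon>)"
              using elim by (simp add: c_def ln_div algebra_simps)
            also have "\<dots> \<le> ln (1 / \<epsilon>) + \<bar>real d * V\<bar> * ln (1 / \<epsilon>)"
              using elim by (intro add_mono mult_right_mono) auto
            also have "\<dots> = \<Lambda>1 * ln (1 / \<epsilon>)" by (simp add: \<Lambda>1_def distrib_right)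
            finally have "ln (2 * card T) \<le> \<Lambda>1 * ln (1 / \<epsilon>)" by simp
            moreover have "\<forall>j<dim_col ?X. L2_set (\<lambda>i. ?X $$ (i, j)) {..<dim_row ?X} \<le> 1"
              using tensor_power_col_norm[OF norm[OF \<Psi>]] by simp
            ultimately show "entropy (dim_row ?X) \<epsilon> (absconv ?X)
              \<le> C' * (\<epsilon> powr (- (2 * W / (2 + W))) * ln (1 / \<epsilon>) ^ (d - 1) * ln (1 / \<epsilon>) powr (W / (2 + W)))"
              using elim(1) cross[OF \<Psi>] T(1) T0 by blast
          qed
        qed
        show "\<forall>\<^sub>F \<epsilon> in at_right 0. 0 < \<epsilon> powr (- (2 * W / (2 + W))) * ln (1 / \<epsilon>) ^ (d - 1) * ln (1 / \<epsilon>) powr (W / (2 + W))"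
          using lnpos epos by eventually_elim auto
      qed
    qed
    ultimately show ?thesis by blast
  qed
  ultimately show ?thesis by blast
qed

end
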